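(* Let $V_n=\mathbb{C}[[t]]/(t^{n+1})$, let $M(n)$ be the arithmetic cost of a product in $V_n$, and let $\mathcal{C}_n$ be the problem of computing the classical cumulants $\kappa_1,\dots,\kappa_n$ from the moments $\mu_1,\dots,\mu_n$, that is, of computing $\log(1+\mathfrak{M})$ in $V_n$ where $\mathfrak{M}=M_X(t)-1$. Then $$L(\mathcal{C}_n)=\Theta(M(n)).$$ The classical method, by enumeration of all set partitions of $\{1,\dots,n\}$, costs $\Theta(n\cdot\mathfrak{B}_n)$, where $\mathfrak{B}_n$ is the $n$-th Bell number, and the separation is superexponential in the sense that $n\,\mathfrak{B}_n/M(n)\to\infty$ faster than any power of $n$.
   Context: $L(\cdot)$ denotes arithmetic complexity in the arithmetic circuit model over $\mathbb{C}$. $M_X(t)=1+\sum_{k\ge1}\mu_k t^k/k!$ is the moment generating function (as a formal series, truncated in $V_n$), and the cumulants are defined by $\log M_X(t)=\sum_{k\ge1}\kappa_kt^k/k!$. $M(n)=O(n\log n)$, and the paper takes $M(2n)\ge 2M(n)$. The classical method evaluates the moment–cumulant formula by visiting every partition of $\{1,\dots,n\}$, with a cost at least linear in $n$ for processing each partition. *)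

theory Defs
  imports
    Complex_Main
    "HOL-Library.Landau_Symbols"
    "HOL-Library.Disjoint_Sets"
    "HOL-Library.More_List"
    "HOL-Library.Time_Functions"
    "HOL-Computational_Algebra.Formal_Power_Series"
begin

section \<open>Arithmetic circuits over the complex numbers\<close>

text \<open>
  A circuit is a list of gates in topological order together with its list of output operands;
  \<open>Gate j\<close> refers to the value of the gate at position \<open>j\<close>. Inputs and constants are leaves and cost
  nothing, and every gate costs one. In particular, multiplication by a scalar is counted.
\<close>

datatype operand = Input nat | Const complex | Gate nat

datatype gate = Add operand operand | Sub operand operand | Mul operand operand

type_synonym circuit = "gate list \<times> operand list"

fun operand_val :: "complex list \<Rightarrow> complex list \<Rightarrow> operand \<Rightarrow> complex" where
  "operand_val xs vs (Input i) = xs ! i"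
| "operand_val xs vs (Const c) = c"
| "operand_val xs vs (Gate j) = vs ! j"

fun gate_val :: "complex list \<Rightarrow> complex list \<Rightarrow> gate \<Rightarrow> complex" where
  "gate_val xs vs (Add p q) = operand_val xs vs p + operand_val xs vs q"
| "gate_val xs vs (Sub p q) = operand_val xs vs p - operand_val xs vs q"
| "gate_val xs vs (Mul p q) = operand_val xs vs p * operand_val xs vs q"

fun gate_vals :: "complex list \<Rightarrow> complex list \<Rightarrow> gate list \<Rightarrow> complex list" where
  "gate_vals xs vs [] = vs"
| "gate_vals xs vs (g # gs) = gate_vals xs (vs @ [gate_val xs vs g]) gs"

definition eval_circuit :: "circuit \<Rightarrow> complex list \<Rightarrow> complex list" where
  "eval_circuit C xs = map (operand_val xs (gate_vals xs [] (fst C))) (snd C)"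

text \<open>Well-formedness: \<open>m\<close> inputs, and gates only refer to the \<open>k\<close> gates preceding them.\<close>

fun wf_operand :: "nat \<Rightarrow> nat \<Rightarrow> operand \<Rightarrow> bool" where
  "wf_operand m k (Input i) \<longleftrightarrow> i < m"
| "wf_operand m k (Const c) \<longleftrightarrow> True"
| "wf_operand m k (Gate j) \<longleftrightarrow> j < k"

fun wf_gate :: "nat \<Rightarrow> nat \<Rightarrow> gate \<Rightarrow> bool" where
  "wf_gate m k (Add p q) \<longleftrightarrow> wf_operand m k p \<and> wf_operand m k q"
| "wf_gate m k (Sub p q) \<longleftrightarrow> wf_operand m k p \<and> wf_operand m k q"
| "wf_gate m k (Mul p q) \<longleftrightarrow> wf_operand m k p \<and> wf_operand m k q"

definition wf_circuit :: "nat \<Rightarrow> circuit \<Rightarrow> bool" where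
  "wf_circuit m C \<longleftrightarrow>
     (\<forall>k<length (fst C). wf_gate m k (fst C ! k)) \<and>
     (\<forall>p\<in>set (snd C). wf_operand m (length (fst C)) p)"

definition circuit_size :: "circuit \<Rightarrow> nat" where
  "circuit_size C = length (fst C)"

text \<open>
  Since \<open>\<complex>\<close> is infinite, agreeing at all points is the same as computing the right polynomials.
\<close>

definition computes :: "nat \<Rightarrow> circuit \<Rightarrow> (complex list \<Rightarrow> complex list) \<Rightarrow> bool" where
  "computes m C F \<longleftrightarrow>
     wf_circuit m C \<and> (\<forall>xs. length xs = m \<longrightarrow> eval_circuit C xs = F xs)"

text \<open>
  \<open>arith_complexity m F\<close> is only meaningful if some circuit computes \<open>F\<close>; this holds for the two
  polynomial maps below.
\<close>

definition arith_complexity :: "nat \<Rightarrow> (complex list \<Rightarrow> complex list) \<Rightarrow> nat" where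
  "arith_complexity m F = (LEAST s. \<exists>C. computes m C F \<and> circuit_size C = s)"


section \<open>Multiplication in \<open>V\<^sub>n = \<complex>[[t]]/(t\<^sup>n\<^sup>+\<^sup>1)\<close>\<close>

text \<open>Elements of \<open>V\<^sub>n\<close> are given by their coefficients of \<open>1, t, \<dots>, t\<^sup>n\<close>.\<close>

definition series_of :: "complex list \<Rightarrow> complex fps" where
  "series_of as = Abs_fps (nth_default 0 as)"

definition coeffs_upto :: "nat \<Rightarrow> complex fps \<Rightarrow> complex list" where
  "coeffs_upto n f = map (fps_nth f) [0..<Suc n]"

definition mult_problem :: "nat \<Rightarrow> complex list \<Rightarrow> complex list" where
  "mult_problem n xs =
     coeffs_upto n (series_of (take (Suc n) xs) * series_of (drop (Suc n) xs))"

definition mult_cost :: "nat \<Rightarrow> nat" where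
  "mult_cost n = arith_complexity (2 * Suc n) (mult_problem n)"


section \<open>Cumulants from moments\<close>

definition mgf :: "(nat \<Rightarrow> complex) \<Rightarrow> complex fps" where
  "mgf \<mu> = Abs_fps (\<lambda>k. if k = 0 then 1 else \<mu> k / fact k)"

text \<open>\<open>fps_ln 1\<close> is the series of \<open>log (1 + t)\<close>.\<close>

definition cumulant :: "(nat \<Rightarrow> complex) \<Rightarrow> nat \<Rightarrow> complex" where
  "cumulant \<mu> k = fact k * fps_nth (fps_ln 1 oo (mgf \<mu> - 1)) k"

text \<open>The list \<open>[\<mu>\<^sub>1, \<dots>, \<mu>\<^sub>n]\<close> as a moment sequence, with \<open>\<mu>\<^sub>0 = 1\<close> and truncated after \<open>\<mu>\<^sub>n\<close>.\<close>

definition moment :: "complex list \<Rightarrow> nat \<Rightarrow> complex" where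
  "moment ms k = nth_default 0 (1 # ms) k"

definition cumulant_problem :: "nat \<Rightarrow> complex list \<Rightarrow> complex list" where
  "cumulant_problem n ms = map (cumulant (moment ms)) [1..<Suc n]"


section \<open>Bell numbers\<close>

definition bell :: "nat \<Rightarrow> nat" where
  "bell n = card {P. partition_on {1..n} P}"


section \<open>The classical method\<close>

text \<open>
  The moment-cumulant formula
  \<open>\<kappa>\<^sub>n = (\<Sum>\<pi>. (-1)\<^bsup>|\<pi>|-1\<^esup> (|\<pi>|-1)! (\<Prod>B\<in>\<pi>. \<mu>\<^bsub>|B|\<^esub>))\<close>
  is evaluated by producing every partition \<open>\<pi>\<close> of \<open>{1..n}\<close>, as a list of blocks, and adding up the
  contributions. Following the usual convention, \<open>T_f\<close> is the running time of \<open>f\<close>: every function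
  call costs one step, and arithmetic operations and moment lookups take constant time within it.
  The length of each block is determined by traversing the block.
\<close>

fun insert_elem :: "nat \<Rightarrow> nat list list \<Rightarrow> nat list list list" where
  "insert_elem x [] = [[[x]]]"
| "insert_elem x (b # bs) = ((x # b) # bs) # map ((#) b) (insert_elem x bs)"

fun T_insert_elem :: "nat \<Rightarrow> nat list list \<Rightarrow> nat" where
  "T_insert_elem x [] = 1"
| "T_insert_elem x (b # bs) = T_insert_elem x bs + T_map (\<lambda>_. 1) (insert_elem x bs) + 1"

fun insert_all :: "nat \<Rightarrow> nat list list list \<Rightarrow> nat list list list" where
  "insert_all x [] = []"
| "insert_all x (P # Ps) = insert_elem x P @ insert_all x Ps"

fun T_insert_all :: "nat \<Rightarrow> nat list list list \<Rightarrow> nat" where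
  "T_insert_all x [] = 1"
| "T_insert_all x (P # Ps) =
     T_insert_elem x P + T_insert_all x Ps + T_append (insert_elem x P) (insert_all x Ps) + 1"

fun set_partitions :: "nat \<Rightarrow> nat list list list" where
  "set_partitions 0 = [[]]"
| "set_partitions (Suc n) = insert_all (Suc n) (set_partitions n)"

fun T_set_partitions :: "nat \<Rightarrow> nat" where
  "T_set_partitions 0 = 1"
| "T_set_partitions (Suc n) = T_set_partitions n + T_insert_all (Suc n) (set_partitions n) + 1"

fun block_product :: "(nat \<Rightarrow> complex) \<Rightarrow> nat list list \<Rightarrow> complex" where
  "block_product \<mu> [] = 1"
| "block_product \<mu> (b # bs) = \<mu> (length b) * block_product \<mu> bs"

fun T_block_product :: "nat list list \<Rightarrow> nat" where
  "T_block_product [] = 1"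
| "T_block_product (b # bs) = T_length b + T_block_product bs + 1"

text \<open>\<open>signed_fact m = (-1)\<^sup>m m!\<close>\<close>

fun signed_fact :: "nat \<Rightarrow> complex" where
  "signed_fact 0 = 1"
| "signed_fact (Suc m) = - of_nat (Suc m) * signed_fact m"

fun T_signed_fact :: "nat \<Rightarrow> nat" where
  "T_signed_fact 0 = 1"
| "T_signed_fact (Suc m) = T_signed_fact m + 1"

definition contribution :: "(nat \<Rightarrow> complex) \<Rightarrow> nat list list \<Rightarrow> complex" where
  "contribution \<mu> P = signed_fact (length P - 1) * block_product \<mu> P"

definition T_contribution :: "nat list list \<Rightarrow> nat" where
  "T_contribution P = T_length P + T_signed_fact (length P - 1) + T_block_product P + 1"

fun sum_contributions :: "(nat \<Rightarrow> complex) \<Rightarrow> nat list list list \<Rightarrow> complex" where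
  "sum_contributions \<mu> [] = 0"
| "sum_contributions \<mu> (P # Ps) = contribution \<mu> P + sum_contributions \<mu> Ps"

fun T_sum_contributions :: "nat list list list \<Rightarrow> nat" where
  "T_sum_contributions [] = 1"
| "T_sum_contributions (P # Ps) = T_contribution P + T_sum_contributions Ps + 1"

text \<open>The \<open>n\<close>-th cumulant, by enumeration of the set partitions of \<open>{1..n}\<close>.\<close>

definition classical_cumulant :: "(nat \<Rightarrow> complex) \<Rightarrow> nat \<Rightarrow> complex" where
  "classical_cumulant \<mu> n = sum_contributions \<mu> (set_partitions n)"

definition T_classical_cumulant :: "nat \<Rightarrow> nat" where
  "T_classical_cumulant n = T_set_partitions n + T_sum_contributions (set_partitions n) + 1"

text \<open>
  All of \<open>\<kappa>\<^sub>1, \<dots>, \<kappa>\<^sub>n\<close>. The step counts do not depend on the values of the moments.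
\<close>

definition classical_cumulants :: "nat \<Rightarrow> complex list \<Rightarrow> complex list" where
  "classical_cumulants n ms = map (classical_cumulant (moment ms)) [1..<Suc n]"

definition T_classical_cumulants :: "nat \<Rightarrow> nat" where
  "T_classical_cumulants n = T_map T_classical_cumulant [1..<Suc n]"

end

theory Submission
  imports
    Defs
    "HOL-Computational_Algebra.Polynomial"
    "HOL-Real_Asymp.Real_Asymp"
begin

text \<open>
  Write \<open>M(n)\<close> for the cost of a product in \<open>V\<^sub>n\<close> and \<open>L(n)\<close> for the cost of the cumulants. Both are sizes
  of optimal circuits, so the comparison is made by using one optimal circuit as a subroutine of
  another circuit.

  Cumulants reduce to products because \<open>log F\<close> is the antiderivative of \<open>F'/F\<close>. Newton's iteration
  \<open>G \<mapsto> G (2 - F G)\<close> doubles the precision of an approximate inverse at the price of two products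
  (\<open>newton_step\<close>), and superlinearity \<open>M(2n) \<ge> 2 M(n)\<close> turns the total over all precisions into a
  geometric sum (\<open>slp_inverse\<close>). The steps that are linear in \<open>n\<close> are absorbed by \<open>M(n) \<ge> n + 1\<close>, which
  holds since the \<open>n + 1\<close> output polynomials are distinct and none is a constant or an input.

  Products reduce to cumulants because \<open>log (1 + \<epsilon> F) = \<epsilon> F - \<epsilon>\<^sup>2 F\<^sup>2 / 2 + \<dots>\<close>: the part of degree two of
  the cumulants, as polynomials in the moments, is a squaring. The parts of degree at most two of all
  the gates of a circuit can be computed from one another with at most eight gates for each original
  one, as in Strassen's homogenization (\<open>slp_jets\<close>). Polarization then gives all products
  (\<open>slp_product_from_cumulants\<close>), and \<open>L(n) \<ge> n - 1\<close> absorbs the linear terms.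

  For the enumeration, the partitions of \<open>{1..n+1}\<close> arise from those of \<open>{1..n}\<close> by putting \<open>n + 1\<close> into one
  of the blocks or into a block of its own (\<open>bij_betw_partition_insert\<close>), just as the program does it.
  A partition with \<open>p\<close> blocks therefore has \<open>p + 1\<close> successors, so that \<open>bell (n + 1)\<close> is the sum of \<open>p + 1\<close>
  over all partitions of \<open>{1..n}\<close>; for \<open>n \<ge> 1\<close> it is at least \<open>2 * bell n\<close>. Evaluating one partition
  takes time linear in \<open>n\<close>, and the time for producing the lists of all levels up to \<open>n\<close> is a geometric
  sum dominated by the last level. Finally \<open>bell n \<ge> 2\<^bsup>n-1\<^esup>\<close> while \<open>M(n) \<le> 2 (n + 1)\<^sup>2\<close> by the schoolbook
  method, and an exponential outgrows every power of \<open>n\<close>.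
\<close>

unbundle fps_syntax

section \<open>Straight-line programs on functions\<close>

definition leaves :: "('x \<Rightarrow> complex) set \<Rightarrow> ('x \<Rightarrow> complex) set" where
  "leaves A = A \<union> range (\<lambda>c _. c)"

definition gate_results :: "('x \<Rightarrow> complex) \<Rightarrow> ('x \<Rightarrow> complex) \<Rightarrow> ('x \<Rightarrow> complex) set" where
  "gate_results f g = {\<lambda>x. f x + g x, \<lambda>x. f x - g x, \<lambda>x. f x * g x}"

text \<open>
  \<open>slp A s B\<close> counts gates without mentioning gate numbers: values are functions of a common
  argument, \<open>A\<close> is the set of values available at the start and \<open>B\<close> a set of values obtained from
  them with at most \<open>s\<close> gates. Since values are compared as functions, programs compose by plain set
  inclusion. The argument type \<open>'x\<close> is arbitrary, so that a program can be run on inputs that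
  are themselves results of other programs.
\<close>

inductive slp :: "('x \<Rightarrow> complex) set \<Rightarrow> nat \<Rightarrow> ('x \<Rightarrow> complex) set \<Rightarrow> bool"
  for A :: "('x \<Rightarrow> complex) set"
where
  slp_leaves: "B \<subseteq> leaves A \<Longrightarrow> slp A 0 B"
| slp_gate: "slp A s B \<Longrightarrow> f \<in> B \<Longrightarrow> g \<in> B \<Longrightarrow> h \<in> gate_results f g \<Longrightarrow> slp A (Suc s) (insert h B)"
| slp_weaken: "slp A s B \<Longrightarrow> C \<subseteq> B \<Longrightarrow> s \<le> t \<Longrightarrow> slp A t C"

lemma leaves_mono: "A \<subseteq> B \<Longrightarrow> leaves A \<subseteq> leaves B"
  by (auto simp: leaves_def)

lemma subset_leaves: "A \<subseteq> leaves A"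
  by (auto simp: leaves_def)

lemma const_in_leaves [simp]: "(\<lambda>_. c) \<in> leaves A"
  by (auto simp: leaves_def)

lemma slp_mono: "slp A s B \<Longrightarrow> A \<subseteq> A' \<Longrightarrow> slp A' s B"
proof (induction rule: slp.induct)
  case (slp_leaves B)
  then show ?case using leaves_mono by (blast intro: slp.slp_leaves)
qed (auto intro: slp.slp_gate slp.slp_weaken)

lemma slp_with_leaves: "slp A s B \<Longrightarrow> slp A s (leaves (A \<union> B))"
proof (induction rule: slp.induct)
  case (slp_leaves B)
  then show ?case by (intro slp.slp_leaves) (auto simp: leaves_def)
next
  case (slp_gate s B f g h)
  then have "slp A (Suc s) (insert h (leaves (A \<union> B)))"
    by (intro slp.slp_gate[of A s _ f g]) (auto simp: leaves_def)
  then show ?case by (rule slp.slp_weaken) (auto simp: leaves_def)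
next
  case (slp_weaken s B C t)
  show ?case
    by (rule slp.slp_weaken[OF slp_weaken.IH]) (use slp_weaken.hyps in \<open>auto simp: leaves_def\<close>)
qed

text \<open>
  Programs are concatenated; the intermediate results \<open>B\<close> remain available afterwards.
\<close>

lemma slp_extend: "slp B t C \<Longrightarrow> slp A s B \<Longrightarrow> slp A (s + t) (B \<union> C)"
proof (induction rule: slp.induct)
  case (slp_leaves C)
  show ?case
    by (rule slp.slp_weaken[OF slp_with_leaves[OF slp_leaves(2)]])
       (use slp_leaves(1) in \<open>auto simp: leaves_def\<close>)
next
  case (slp_gate t C f g h)
  then have "slp A (Suc (s + t)) (insert h (B \<union> C))"
    by (intro slp.slp_gate[of A "s + t" _ f g]) auto
  then show ?case by simp
next
  case (slp_weaken t C D t')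
  then show ?case by (blast intro: slp.slp_weaken add_left_mono)
qed

lemma slp_trans: "slp A s B \<Longrightarrow> slp B t C \<Longrightarrow> slp A (s + t) C"
  by (rule slp_weaken[OF slp_extend]) auto

lemma slp_from_leaves: "slp A' t C \<Longrightarrow> A' \<subseteq> leaves A \<Longrightarrow> slp A t C"
  using slp_trans[OF slp_leaves[of A' A]] by simp

text \<open>
  The form of concatenation for building programs step by step: the next step may use the original
  values, all results so far, and constants.
\<close>

lemma slp_continue:
  assumes "slp A s B" "slp A' t C" "A' \<subseteq> leaves (A \<union> B)"
  shows "slp A (s + t) (B \<union> C)"
proof -
  have "slp (leaves (A \<union> B)) t C" using assms(2,3) by (rule slp_mono)
  from slp_extend[OF this slp_with_leaves[OF assms(1)]] show ?thesis
    by (rule slp_weaken) (auto simp: leaves_def)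
qed

lemma slp_Un:
  assumes "slp A s B" "slp A t C"
  shows "slp A (s + t) (B \<union> C)"
proof -
  have "slp A s (A \<union> B)"
    by (rule slp_weaken[OF slp_with_leaves[OF assms(1)]]) (auto simp: leaves_def)
  moreover have "slp (A \<union> B) t C" using assms(2) by (rule slp_mono) simp
  ultimately have "slp A (s + t) (A \<union> B \<union> C)" by (intro slp_extend)
  then show ?thesis by (rule slp_weaken) auto
qed

lemma slp_UN:
  assumes "finite K" "\<And>k. k \<in> K \<Longrightarrow> slp A s (B k)"
  shows "slp A (card K * s) (\<Union>k\<in>K. B k)"
  using assms
proof (induction K rule: finite_induct)
  case empty
  then show ?case by (auto intro: slp_leaves)
next
  case (insert k K)
  then have "slp A (s + card K * s) (B k \<union> (\<Union>k\<in>K. B k))" by (intro slp_Un) auto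
  then show ?case using insert.hyps by simp
qed

text \<open>
  One gate for each member of a family, all gates being applied to values that are already there.
\<close>

lemma slp_family:
  assumes "finite K" "\<And>k. k \<in> K \<Longrightarrow> \<exists>f\<in>leaves A. \<exists>g\<in>leaves A. h k \<in> gate_results f g"
  shows "slp A (card K) (h ` K)"
proof -
  have "slp A 1 {h k}" if k: "k \<in> K" for k
  proof -
    obtain f g where fg: "f \<in> leaves A" "g \<in> leaves A" "h k \<in> gate_results f g"
      using assms(2)[OF k] by blast
    have "slp A (Suc 0) (insert (h k) (leaves A))"
      by (rule slp_gate[OF slp_leaves]) (use fg in auto)
    then show ?thesis by (rule slp_weaken) auto
  qed
  from slp_UN[OF assms(1) this, of "\<lambda>k. k"] have "slp A (card K * 1) (\<Union>k\<in>K. {h k})" by blast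
  then show ?thesis by (simp add: UNION_singleton_eq_range)
qed

lemma slp_sum:
  assumes "finite I" "\<And>i. i \<in> I \<Longrightarrow> f i \<in> leaves A"
  shows "slp A (card I) {\<lambda>x. \<Sum>i\<in>I. f i x}"
  using assms
proof (induction I rule: finite_induct)
  case empty
  then show ?case by (auto intro!: slp_leaves)
next
  case (insert i I)
  let ?S = "\<lambda>x. \<Sum>i\<in>I. f i x"
  have "slp A (card I) (leaves (A \<union> {?S}))" using insert by (intro slp_with_leaves) auto
  then have "slp A (Suc (card I)) (insert (\<lambda>x. f i x + ?S x) (leaves (A \<union> {?S})))"
    by (rule slp_gate[of _ _ _ "f i" ?S])
      (use insert.prems in \<open>auto simp: gate_results_def leaves_def\<close>)
  then show ?case using insert.hyps by (auto intro: slp_weaken)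
qed

text \<open>
  A program does not depend on where its input values come from.
\<close>

lemma slp_substitute:
  "slp A s B \<Longrightarrow> slp ((\<lambda>f x. f (\<phi> x)) ` A) s ((\<lambda>f x. f (\<phi> x)) ` B)"
proof (induction rule: slp.induct)
  case (slp_leaves B)
  then show ?case by (intro slp.slp_leaves) (auto simp: leaves_def image_iff subset_iff)
next
  case (slp_gate s B f g h)
  let ?s = "\<lambda>f x. f (\<phi> x)"
  have "?s h \<in> gate_results (?s f) (?s g)"
    using slp_gate.hyps(4) by (auto simp: gate_results_def)
  then show ?case using slp_gate unfolding image_insert by (auto intro: slp.slp_gate)
next
  case (slp_weaken s B C t)
  then show ?case by (auto intro: slp.slp_weaken)
qed

text \<open>
  A gate produces one value. This gives the linear lower bounds on the size: distinct outputs that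
  are neither inputs nor constants need one gate each.
\<close>

lemma card_le_slp:
  "slp A s B \<Longrightarrow> finite (B - leaves A) \<and> card (B - leaves A) \<le> s"
proof (induction rule: slp.induct)
  case (slp_leaves B)
  then have "B - leaves A = {}" by blast
  then show ?case by (metis card.empty finite.emptyI order_refl)
next
  case (slp_gate s B f g h)
  have *: "insert h B - leaves A \<subseteq> insert h (B - leaves A)" by auto
  have "card (insert h B - leaves A) \<le> card (insert h (B - leaves A))"
    using slp_gate by (intro card_mono[OF _ *]) auto
  also have "\<dots> \<le> Suc s" using slp_gate by (auto simp: card_insert_if)
  finally show ?case using * slp_gate by (auto intro: finite_subset)
next
  case (slp_weaken s B C t)
  have *: "C - leaves A \<subseteq> B - leaves A" using slp_weaken by auto
  show ?case
    using card_mono[OF _ *] finite_subset[OF *] slp_weaken by auto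
qed

section \<open>Circuits as straight-line programs\<close>

lemma gate_vals_append: "gate_vals xs vs (gs @ hs) = gate_vals xs (gate_vals xs vs gs) hs"
  by (induction gs arbitrary: vs) auto

lemma length_gate_vals [simp]: "length (gate_vals xs vs gs) = length vs + length gs"
  by (induction gs arbitrary: vs) auto

lemma operand_val_append:
  "wf_operand m (length vs) p \<Longrightarrow> operand_val xs (vs @ ws) p = operand_val xs vs p"
  by (cases p) (auto simp: nth_append)

lemma wf_operand_mono: "wf_operand m k p \<Longrightarrow> k \<le> l \<Longrightarrow> wf_operand m l p"
  by (cases p) auto

lemma operand_val_in_leaves:
  assumes "wf_operand m (length ws) p"
  shows "(\<lambda>x. operand_val (map (\<lambda>i. us i x) [0..<m]) (map (\<lambda>w. w x) ws) p)
    \<in> leaves (us ` {..<m} \<union> set ws)"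
  using assms by (cases p) (auto simp: leaves_def)

lemma slp_gate_vals:
  assumes "\<forall>j<length gs. wf_gate m (length ws + j) (gs ! j)" "slp (us ` {..<m}) s (set ws)"
  shows "\<exists>ws'. slp (us ` {..<m}) (s + length gs) (set ws') \<and> length ws' = length ws + length gs \<and>
    (\<forall>x. gate_vals (map (\<lambda>i. us i x) [0..<m]) (map (\<lambda>w. w x) ws) gs = map (\<lambda>w. w x) ws')"
  using assms
proof (induction gs arbitrary: ws s)
  case Nil
  then show ?case by auto
next
  case (Cons g gs)
  let ?A = "us ` {..<m}"
  let ?op = "\<lambda>p x. operand_val (map (\<lambda>i. us i x) [0..<m]) (map (\<lambda>w. w x) ws) p"
  let ?h = "\<lambda>x. gate_val (map (\<lambda>i. us i x) [0..<m]) (map (\<lambda>w. w x) ws) g"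
  have g: "wf_gate m (length ws) g" using Cons.prems(1) by force
  obtain p q where pq: "wf_operand m (length ws) p" "wf_operand m (length ws) q"
    "?h \<in> gate_results (?op p) (?op q)"
    using g by (cases g) (auto simp: gate_results_def)
  have "slp ?A (Suc s) (insert ?h (leaves (?A \<union> set ws)))"
    by (rule slp_gate[OF slp_with_leaves[OF Cons.prems(2)] operand_val_in_leaves[OF pq(1)]
          operand_val_in_leaves[OF pq(2)] pq(3)])
  then have "slp ?A (Suc s) (set (ws @ [?h]))"
    by (rule slp_weaken) (auto simp: leaves_def)
  moreover have "\<forall>j<length gs. wf_gate m (length (ws @ [?h]) + j) (gs ! j)"
    using Cons.prems(1) by force
  ultimately obtain ws' where "slp ?A (Suc s + length gs) (set ws')"
    "length ws' = length (ws @ [?h]) + length gs"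
    "\<forall>x. gate_vals (map (\<lambda>i. us i x) [0..<m]) (map (\<lambda>w. w x) (ws @ [?h])) gs = map (\<lambda>w. w x) ws'"
    using Cons.IH by blast
  then show ?case by (intro exI[of _ ws']) auto
qed

text \<open>
  The input values \<open>us i\<close> are arbitrary functions of some parameter \<open>x\<close>. This is what allows a circuit to
  be used as a subroutine.
\<close>

lemma computes_imp_slp:
  assumes "computes m C F" "\<And>xs. length xs = m \<Longrightarrow> length (F xs) = r"
  shows "slp (us ` {..<m}) (circuit_size C) ((\<lambda>k x. F (map (\<lambda>i. us i x) [0..<m]) ! k) ` {..<r})"
proof -
  let ?A = "us ` {..<m}" and ?in = "\<lambda>x. map (\<lambda>i. us i x) [0..<m]"
  have wf: "wf_circuit m C" and F: "\<And>x. eval_circuit C (?in x) = F (?in x)"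
    using assms(1) by (auto simp: computes_def)
  have "length (eval_circuit C (?in undefined)) = r" unfolding F using assms(2) by auto
  then have r: "length (snd C) = r" by (simp add: eval_circuit_def)
  have "slp ?A 0 (set [])" by (rule slp_leaves) auto
  with wf obtain ws where ws: "slp ?A (length (fst C)) (set ws)" "length ws = length (fst C)"
    "\<And>x. gate_vals (?in x) [] (fst C) = map (\<lambda>w. w x) ws"
    using slp_gate_vals[of "fst C" m "[]" us 0] by (auto simp: wf_circuit_def)
  have "(\<lambda>x. F (?in x) ! k) \<in> leaves (?A \<union> set ws)" if "k < r" for k
  proof -
    have eq: "(\<lambda>x. F (?in x) ! k) = (\<lambda>x. operand_val (?in x) (map (\<lambda>w. w x) ws) (snd C ! k))"
      using that r by (auto simp: F[symmetric] eval_circuit_def ws(3))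
    have "wf_operand m (length ws) (snd C ! k)"
      using wf that r by (auto simp: wf_circuit_def ws(2))
    then show ?thesis unfolding eq by (rule operand_val_in_leaves)
  qed
  then show ?thesis unfolding circuit_size_def
    by (intro slp_weaken[OF slp_with_leaves[OF ws(1)]]) auto
qed

text \<open>
  Conversely, every derivation of \<open>slp\<close> over the coordinate functions can be written down as a list of
  gates, in the order in which the derivation adds them.
\<close>

lemma slp_imp_gates:
  assumes "slp ((\<lambda>i x. x i) ` {..<m}) s B"
  shows "\<exists>gs. length gs \<le> s \<and> (\<forall>k<length gs. wf_gate m k (gs ! k)) \<and>
    (\<forall>f\<in>B. \<exists>p. wf_operand m (length gs) p \<and>
      (\<forall>x. f x = operand_val (map x [0..<m]) (gate_vals (map x [0..<m]) [] gs) p))"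
  using assms
proof (induction rule: slp.induct)
  case (slp_leaves B)
  have "\<exists>p. wf_operand m 0 p \<and> (\<forall>x. f x = operand_val (map x [0..<m]) [] p)" if "f \<in> B" for f
  proof -
    from slp_leaves that consider i where "i < m" "f = (\<lambda>x. x i)" | c where "f = (\<lambda>_. c)"
      by (auto simp: leaves_def)
    then show ?thesis
    proof cases
      case 1 then show ?thesis by (intro exI[of _ "Input i"]) auto
    next
      case 2 then show ?thesis by (intro exI[of _ "Const c"]) auto
    qed
  qed
  then show ?case by (intro exI[of _ "[]"]) auto
next
  case (slp_gate s B f g h)
  then obtain gs where gs: "length gs \<le> s" "\<forall>k<length gs. wf_gate m k (gs ! k)"
    "\<forall>f\<in>B. \<exists>p. wf_operand m (length gs) p \<and>
      (\<forall>x. f x = operand_val (map x [0..<m]) (gate_vals (map x [0..<m]) [] gs) p)"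
    by blast
  let ?v = "\<lambda>x. gate_vals (map x [0..<m]) [] gs"
  obtain p where p: "wf_operand m (length gs) p" "\<And>x. f x = operand_val (map x [0..<m]) (?v x) p"
    using gs(3) slp_gate.hyps by blast
  obtain q where q: "wf_operand m (length gs) q" "\<And>x. g x = operand_val (map x [0..<m]) (?v x) q"
    using gs(3) slp_gate.hyps by blast
  obtain e where e: "wf_gate m (length gs) e" "\<And>x. h x = gate_val (map x [0..<m]) (?v x) e"
  proof -
    from slp_gate.hyps(4) consider "h = (\<lambda>x. f x + g x)" | "h = (\<lambda>x. f x - g x)" | "h = (\<lambda>x. f x * g x)"
      by (auto simp: gate_results_def)
    then show ?thesis
    proof cases
      case 1 then show ?thesis using that[of "Add p q"] p q by auto
    next
      case 2 then show ?thesis using that[of "Sub p q"] p q by auto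
    next
      case 3 then show ?thesis using that[of "Mul p q"] p q by auto
    qed
  qed
  let ?gs = "gs @ [e]"
  have v: "gate_vals (map x [0..<m]) [] ?gs = ?v x @ [h x]" for x
    by (simp add: gate_vals_append e)
  have "\<exists>p. wf_operand m (length ?gs) p \<and>
      (\<forall>x. f x = operand_val (map x [0..<m]) (gate_vals (map x [0..<m]) [] ?gs) p)"
    if f: "f \<in> insert h B" for f
  proof (cases "f = h")
    case True
    then show ?thesis unfolding v by (intro exI[of _ "Gate (length gs)"]) (auto simp: nth_append)
  next
    case False
    then obtain p where p: "wf_operand m (length gs) p"
        "\<And>x. f x = operand_val (map x [0..<m]) (?v x) p"
      using gs(3) f by blast
    have "operand_val (map x [0..<m]) (?v x @ [h x]) p = operand_val (map x [0..<m]) (?v x) p" for x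
      by (rule operand_val_append[where m = m]) (use p(1) in simp)
    moreover have "wf_operand m (length ?gs) p" using wf_operand_mono[OF p(1)] by simp
    ultimately show ?thesis unfolding v p(2) by metis
  qed
  moreover have "\<forall>k<length ?gs. wf_gate m k (?gs ! k)"
    using gs(2) e(1) by (auto simp: nth_append less_Suc_eq)
  ultimately show ?case using gs(1) by (intro exI[of _ ?gs]) auto
next
  case (slp_weaken s B C t)
  then show ?case by (meson order_trans subsetD)
qed

lemma slp_imp_computes:
  assumes "slp ((\<lambda>i x. x i) ` {..<m}) s ((\<lambda>k x. F (map x [0..<m]) ! k) ` {..<r})"
    and "\<And>xs. length xs = m \<Longrightarrow> length (F xs) = r"
  shows "\<exists>C. computes m C F \<and> circuit_size C \<le> s"
proof -
  obtain gs where gs: "length gs \<le> s" "\<forall>k<length gs. wf_gate m k (gs ! k)"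
    "\<And>k. k < r \<Longrightarrow> \<exists>p. wf_operand m (length gs) p \<and>
      (\<forall>x. F (map x [0..<m]) ! k = operand_val (map x [0..<m]) (gate_vals (map x [0..<m]) [] gs) p)"
    using slp_imp_gates[OF assms(1)] by auto
  then obtain p where p: "\<And>k. k < r \<Longrightarrow> wf_operand m (length gs) (p k)"
    "\<And>k x. k < r \<Longrightarrow>
      F (map x [0..<m]) ! k = operand_val (map x [0..<m]) (gate_vals (map x [0..<m]) [] gs) (p k)"
    by metis
  let ?C = "(gs, map p [0..<r])"
  have "wf_circuit m ?C" using gs(2) p(1) by (auto simp: wf_circuit_def)
  moreover have "eval_circuit ?C xs = F xs" if "length xs = m" for xs
  proof -
    have xs: "map (nth xs) [0..<m] = xs" using that by (metis map_nth)
    show ?thesis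
      by (rule nth_equalityI)
        (use p(2)[of _ "nth xs"] assms(2)[OF that] in \<open>auto simp: eval_circuit_def xs\<close>)
  qed
  ultimately show ?thesis using gs(1)
    by (intro exI[of _ ?C]) (auto simp: computes_def circuit_size_def)
qed

lemma arith_complexity_le:
  assumes "slp ((\<lambda>i x. x i) ` {..<m}) s ((\<lambda>k x. F (map x [0..<m]) ! k) ` {..<r})"
    and "\<And>xs. length xs = m \<Longrightarrow> length (F xs) = r"
  shows "arith_complexity m F \<le> s"
proof -
  obtain C where C: "computes m C F" "circuit_size C \<le> s" using slp_imp_computes[OF assms] by blast
  then have "arith_complexity m F \<le> circuit_size C"
    unfolding arith_complexity_def by (intro Least_le) blast
  then show ?thesis using C by simp
qed

text \<open>
  The minimum in \<open>arith_complexity\<close> is attained as soon as some program exists.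
\<close>

lemma slp_arith_complexity:
  assumes "slp ((\<lambda>i x. x i) ` {..<m}) s ((\<lambda>k x. F (map x [0..<m]) ! k) ` {..<r})"
    and "\<And>xs. length xs = m \<Longrightarrow> length (F xs) = r"
  shows "slp (us ` {..<m}) (arith_complexity m F)
    ((\<lambda>k x. F (map (\<lambda>i. us i x) [0..<m]) ! k) ` {..<r})"
proof -
  obtain D where "computes m D F" using slp_imp_computes[OF assms] by blast
  then have "\<exists>C. computes m C F \<and> circuit_size C = circuit_size D" by blast
  from LeastI[of "\<lambda>s. \<exists>C. computes m C F \<and> circuit_size C = s", OF this]
  obtain C where C: "computes m C F" "circuit_size C = arith_complexity m F"
    unfolding arith_complexity_def[symmetric] by (elim exE conjE)
  have "slp (us ` {..<m}) (circuit_size C) ((\<lambda>k x. F (map (\<lambda>i. us i x) [0..<m]) ! k) ` {..<r})"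
    by (rule computes_imp_slp[OF C(1) assms(2)])
  then show ?thesis by (simp only: C(2))
qed

section \<open>Multiplication of truncated power series\<close>

text \<open>
  The series \<open>F x\<close> depends on the input \<open>x\<close> of the program, so that each of its coefficients is a value
  in the sense of \<open>slp\<close>.
\<close>

definition coefs :: "nat \<Rightarrow> ('x \<Rightarrow> complex fps) \<Rightarrow> ('x \<Rightarrow> complex) set" where
  "coefs n F = (\<lambda>k x. F x $ k) ` {..n}"

lemma coefsI: "k \<le> n \<Longrightarrow> (\<lambda>x. F x $ k) \<in> coefs n F"
  by (auto simp: coefs_def)

lemma coefs_cong:
  assumes "\<And>k x. k \<le> n \<Longrightarrow> F x $ k = G x $ k"
  shows "coefs n F = coefs n G"
  using assms by (auto simp: coefs_def image_iff)

lemma coefs_subsetI: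
  "(\<And>k. k \<le> n \<Longrightarrow> (\<lambda>x. F x $ k) \<in> B) \<Longrightarrow> coefs n F \<subseteq> B"
  by (auto simp: coefs_def)

lemma coefs_in: "coefs n F \<subseteq> B \<Longrightarrow> k \<le> n \<Longrightarrow> (\<lambda>x. F x $ k) \<in> B"
  by (auto simp: coefs_def)

lemma slp_coefs:
  assumes "\<And>k. k \<le> n \<Longrightarrow> \<exists>f\<in>leaves A. \<exists>g\<in>leaves A. (\<lambda>x. H x $ k) \<in> gate_results f g"
  shows "slp A (Suc n) (coefs n H)"
  using slp_family[of "{..n}" A "\<lambda>k x. H x $ k"] assms by (simp add: coefs_def)

lemma slp_coefs_add:
  assumes "coefs n F \<subseteq> leaves A" "coefs n G \<subseteq> leaves A"
  shows "slp A (Suc n) (coefs n (\<lambda>x. F x + G x))"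
proof (rule slp_coefs)
  fix k assume "k \<le> n"
  then show "\<exists>f\<in>leaves A. \<exists>g\<in>leaves A. (\<lambda>x. (F x + G x) $ k) \<in> gate_results f g"
    using assms[THEN coefs_in] by (intro bexI) (auto simp: gate_results_def)
qed

lemma slp_coefs_diff:
  assumes "coefs n F \<subseteq> leaves A" "coefs n G \<subseteq> leaves A"
  shows "slp A (Suc n) (coefs n (\<lambda>x. F x - G x))"
proof (rule slp_coefs)
  fix k assume "k \<le> n"
  then show "\<exists>f\<in>leaves A. \<exists>g\<in>leaves A. (\<lambda>x. (F x - G x) $ k) \<in> gate_results f g"
    using assms[THEN coefs_in] by (intro bexI) (auto simp: gate_results_def)
qed

lemma slp_coefs_scale:
  assumes "c \<in> leaves A" "coefs n F \<subseteq> leaves A"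
  shows "slp A (Suc n) (coefs n (\<lambda>x. fps_const (c x) * F x))"
proof (rule slp_coefs)
  fix k assume "k \<le> n"
  then show "\<exists>f\<in>leaves A. \<exists>g\<in>leaves A. (\<lambda>x. (fps_const (c x) * F x) $ k) \<in> gate_results f g"
    using assms(1) coefs_in[OF assms(2)]
    by (intro bexI[of _ c] bexI[of _ "\<lambda>x. F x $ k"]) (auto simp: gate_results_def)
qed

lemma length_mult_problem [simp]: "length (mult_problem n xs) = Suc n"
  by (simp add: mult_problem_def coeffs_upto_def)

lemma mult_problem_nth:
  assumes "k \<le> n"
  shows "mult_problem n (map f [0..<2 * Suc n]) ! k = (\<Sum>i\<le>k. f i * f (Suc n + (k - i)))"
proof -
  let ?xs = "map f [0..<2 * Suc n]"
  have "mult_problem n ?xs ! k = (series_of (take (Suc n) ?xs) * series_of (drop (Suc n) ?xs)) $ k"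
    using assms by (simp add: mult_problem_def coeffs_upto_def del: upt_Suc)
  also have "\<dots> = (\<Sum>i=0..k. f i * f (Suc n + (k - i)))"
    unfolding fps_mult_nth
    by (intro sum.cong) (use assms in \<open>auto simp: series_of_def nth_default_def take_map drop_map
        simp del: upt_Suc\<close>)
  finally show ?thesis by (simp add: atLeast0AtMost)
qed

text \<open>
  All \<open>(n + 1)\<^sup>2\<close> products of two coefficients, and then at most \<open>n + 1\<close> additions for each of the \<open>n + 1\<close>
  results.
\<close>

lemma slp_schoolbook:
  "slp ((\<lambda>i x. x i) ` {..<2 * Suc n}) (2 * (Suc n)\<^sup>2)
     ((\<lambda>k x. mult_problem n (map x [0..<2 * Suc n]) ! k) ` {..<Suc n})"
proof -
  let ?A = "(\<lambda>i x. x i) ` {..<2 * Suc n} :: ((nat \<Rightarrow> complex) \<Rightarrow> complex) set"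
  let ?h = "\<lambda>(i, j) x. x i * x (Suc n + j) :: complex"
  let ?P = "?h ` ({..n} \<times> {..n})"
  have P: "slp ?A (card ({..n} \<times> {..n})) ?P"
  proof (rule slp_family)
    fix k assume "k \<in> {..n} \<times> {..n}"
    then show "\<exists>f\<in>leaves ?A. \<exists>g\<in>leaves ?A. ?h k \<in> gate_results f g"
      by (intro bexI[of _ "\<lambda>x. x (fst k)"] bexI[of _ "\<lambda>x. x (Suc n + snd k)"])
        (auto simp: gate_results_def leaves_def)
  qed simp
  have "slp ?P (Suc n) {\<lambda>x. \<Sum>i\<le>k. ?h (i, k - i) x}" if "k \<in> {..<Suc n}" for k
  proof -
    have "?h (i, k - i) \<in> ?P" if "i \<in> {..k}" for i
      by (rule imageI) (use that \<open>k \<in> {..<Suc n}\<close> in auto)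
    then have "slp ?P (card {..k}) {\<lambda>x. \<Sum>i\<le>k. ?h (i, k - i) x}"
      by (intro slp_sum subsetD[OF subset_leaves]) auto
    then show ?thesis by (rule slp_weaken) (use that in auto)
  qed
  from slp_UN[OF _ this, of "{..<Suc n}"]
  have "slp ?P (Suc n * Suc n) (\<Union>k\<in>{..<Suc n}. {\<lambda>x. \<Sum>i\<le>k. ?h (i, k - i) x})" by simp
  from slp_trans[OF P this] show ?thesis
  proof (rule slp_weaken)
    have "(\<lambda>x. mult_problem n (map x [0..<2 * Suc n]) ! k) = (\<lambda>x. \<Sum>i\<le>k. ?h (i, k - i) x)"
      if "k < Suc n" for k
      unfolding case_prod_conv by (rule ext, rule mult_problem_nth) (use that in simp)
    then show "(\<lambda>k x. mult_problem n (map x [0..<2 * Suc n]) ! k) ` {..<Suc n}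
        \<subseteq> (\<Union>k\<in>{..<Suc n}. {\<lambda>x. \<Sum>i\<le>k. ?h (i, k - i) x})"
      by blast
  qed (simp add: power2_eq_square)
qed

lemma mult_cost_le: "mult_cost n \<le> 2 * (Suc n)\<^sup>2"
  unfolding mult_cost_def by (rule arith_complexity_le[OF slp_schoolbook length_mult_problem])

text \<open>
  An optimal multiplication circuit as a subroutine.
\<close>

lemma slp_mult:
  assumes "coefs n F \<subseteq> leaves A" "coefs n G \<subseteq> leaves A"
  shows "slp A (mult_cost n) (coefs n (\<lambda>x. F x * G x))"
proof -
  let ?us = "\<lambda>i x. if i \<le> n then F x $ i else G x $ (i - Suc n)"
  have "slp (?us ` {..<2 * Suc n}) (mult_cost n)
      ((\<lambda>k x. mult_problem n (map (\<lambda>i. ?us i x) [0..<2 * Suc n]) ! k) ` {..<Suc n})"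
    unfolding mult_cost_def by (rule slp_arith_complexity[OF slp_schoolbook length_mult_problem])
  moreover have "mult_problem n (map (\<lambda>i. ?us i x) [0..<2 * Suc n]) ! k = (F x * G x) $ k"
    if "k \<le> n" for k x
    unfolding mult_problem_nth[OF that] fps_mult_nth atLeast0AtMost
    by (intro sum.cong) (use that in auto)
  then have "(\<lambda>k x. mult_problem n (map (\<lambda>i. ?us i x) [0..<2 * Suc n]) ! k) ` {..<Suc n}
      = coefs n (\<lambda>x. F x * G x)"
    unfolding coefs_def lessThan_Suc_atMost by (intro image_cong) (auto simp del: upt_Suc)
  moreover have "?us ` {..<2 * Suc n} \<subseteq> leaves A"
  proof
    fix f assume "f \<in> ?us ` {..<2 * Suc n}"
    then obtain i where i: "i < 2 * Suc n" "f = ?us i" by blast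
    show "f \<in> leaves A"
    proof (cases "i \<le> n")
      case True
      then show ?thesis using coefs_in[OF assms(1)] i(2) by simp
    next
      case False
      then show ?thesis using coefs_in[OF assms(2), of "i - Suc n"] i by simp
    qed
  qed
  ultimately show ?thesis by (auto intro: slp_from_leaves)
qed

text \<open>
  A circuit for the larger precision multiplies the shorter series once they are padded by zeros,
  which are constants and cost nothing.
\<close>

lemma mult_cost_mono:
  assumes "m \<le> n"
  shows "mult_cost m \<le> mult_cost n"
proof -
  let ?A = "(\<lambda>i x. x i) ` {..<2 * Suc m} :: ((nat \<Rightarrow> complex) \<Rightarrow> complex) set"
  let ?F = "\<lambda>x :: nat \<Rightarrow> complex. Abs_fps (\<lambda>i. if i \<le> m then x i else 0)"
  let ?G = "\<lambda>x :: nat \<Rightarrow> complex. Abs_fps (\<lambda>i. if i \<le> m then x (Suc m + i) else 0)"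
  have padded: "coefs n (\<lambda>x. Abs_fps (\<lambda>i. if i \<le> m then x (f i) else 0)) \<subseteq> leaves ?A"
    if f: "\<And>i. i \<le> m \<Longrightarrow> f i < 2 * Suc m" for f
  proof (rule coefs_subsetI)
    fix k
    show "(\<lambda>x. Abs_fps (\<lambda>i. if i \<le> m then x (f i) else 0) $ k) \<in> leaves ?A"
      using f[of k] by (cases "k \<le> m") (auto simp: leaves_def)
  qed
  have "slp ?A (mult_cost n) (coefs n (\<lambda>x. ?F x * ?G x))"
    by (rule slp_mult; rule padded) auto
  moreover have "mult_problem m (map x [0..<2 * Suc m]) ! k = (?F x * ?G x) $ k"
    if "k < Suc m" for k and x :: "nat \<Rightarrow> complex"
  proof -
    have k: "k \<le> m" using that by simp
    show ?thesis unfolding mult_problem_nth[OF k] fps_mult_nth atLeast0AtMost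
      by (intro sum.cong) (use k in auto)
  qed
  then have "(\<lambda>k x. mult_problem m (map x [0..<2 * Suc m]) ! k) ` {..<Suc m}
      \<subseteq> coefs n (\<lambda>x. ?F x * ?G x)"
    using assms by (force simp: coefs_def simp del: upt_Suc)
  ultimately have "slp ?A (mult_cost n)
      ((\<lambda>k x. mult_problem m (map x [0..<2 * Suc m]) ! k) ` {..<Suc m})"
    by (auto intro: slp_weaken)
  then show ?thesis unfolding mult_cost_def[of m]
    by (rule arith_complexity_le[OF _ length_mult_problem])
qed

text \<open>
  The coefficient of \<open>t\<^sup>k\<close> is a sum of products of one coefficient of each factor. At the point where the
  zeroth coefficient of the first factor and the \<open>k\<close>-th coefficient of the second one are \<open>c\<close>, and all
  others vanish, it is \<open>c\<^sup>2\<close>, while the other outputs are zero. So the outputs are distinct, and they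
  depend on \<open>c\<close> neither like an input nor like a constant.
\<close>

lemma mult_cost_ge: "Suc n \<le> mult_cost n"
proof -
  let ?A = "(\<lambda>i x. x i) ` {..<2 * Suc n} :: ((nat \<Rightarrow> complex) \<Rightarrow> complex) set"
  let ?h = "\<lambda>k (x :: nat \<Rightarrow> complex). mult_problem n (map x [0..<2 * Suc n]) ! k"
  \<comment> \<open>input \<open>Suc n + k\<close> is the \<open>k\<close>-th coefficient of the second factor\<close>
  let ?p = "\<lambda>k c i. if i = 0 \<or> i = Suc n + k then c else 0 :: complex"
  have "slp ?A (mult_cost n) (?h ` {..<Suc n})"
    unfolding mult_cost_def by (rule slp_arith_complexity[OF slp_schoolbook length_mult_problem])
  from card_le_slp[OF this] have le: "card (?h ` {..<Suc n} - leaves ?A) \<le> mult_cost n" by simp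
  have h: "?h j (?p k c) = (if j = k then c * c else 0)" if "j \<le> n" for j k c
  proof -
    have "?h j (?p k c) = (\<Sum>i\<le>j. if i = 0 then if j = k then c * c else 0 else 0)"
      unfolding mult_problem_nth[OF that] by (intro sum.cong) (use that in auto)
    then show ?thesis by simp
  qed
  have "inj_on ?h {..<Suc n}"
  proof (rule inj_onI)
    fix j k assume jk: "j \<in> {..<Suc n}" "k \<in> {..<Suc n}" "?h j = ?h k"
    from fun_cong[OF jk(3), of "?p k 1"] show "j = k" using jk(1,2) h[of j k 1] h[of k k 1]
      by (simp del: upt_Suc split: if_splits)
  qed
  moreover have "?h k \<notin> leaves ?A" if "k < Suc n" for k
  proof
    assume "?h k \<in> leaves ?A"
    then consider i where "?h k = (\<lambda>x. x i)" | c where "?h k = (\<lambda>_. c)"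
      by (auto simp: leaves_def)
    then show False
    proof cases
      case 1
      from fun_cong[OF this, of "?p k 2"] show False
        using that h[of k k 2] by (simp del: upt_Suc split: if_splits)
    next
      case 2
      from fun_cong[OF this, of "?p k 2"] fun_cong[OF this, of "?p k 1"]
      show False using that h[of k k 2] h[of k k 1] by (simp del: upt_Suc)
    qed
  qed
  then have "?h ` {..<Suc n} - leaves ?A = ?h ` {..<Suc n}" by blast
  ultimately show ?thesis using le by (simp add: card_image)
qed

section \<open>Inversion by Newton iteration\<close>

text \<open>
  If \<open>e = 1 - F G\<close> is the error of \<open>G\<close>, then \<open>G (2 - F G) = 1/F (1 - e) (1 + e) = 1/F (1 - e\<^sup>2)\<close>. When \<open>e\<close>
  vanishes below order \<open>m\<close>, its square vanishes below order \<open>2 m\<close>.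
\<close>

lemma newton_step:
  fixes F :: "complex fps"
  assumes "F $ 0 \<noteq> 0" "k < 2 * m"
  defines "G \<equiv> fps_cutoff m (inverse F)"
  shows "(G * (2 - F * G)) $ k = inverse F $ k"
proof -
  define e where "e = 1 - F * G"
  have F: "F * inverse F = 1" using assms(1) by (simp add: inverse_mult_eq_1')
  have e: "e $ i = 0" if "i < m" for i
    using that by (simp add: e_def G_def fps_cutoff_right_mult_nth F del: fps_mult_nth_0)
  have "(e * e) $ i = 0" if "i \<le> k" for i
    unfolding fps_mult_nth
  proof (rule sum.neutral, rule ballI)
    fix j assume "j \<in> {0..i}"
    then have "j < m \<or> i - j < m" using that assms(2) by auto
    then show "e $ j * e $ (i - j) = 0" using e by auto
  qed
  then have "(inverse F * (e * e)) $ k = 0"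
    unfolding fps_mult_nth[of "inverse F"] by (intro sum.neutral) auto
  moreover have "G * (2 - F * G) = inverse F - inverse F * (e * e)"
  proof -
    have "G = (F * inverse F) * G" by (simp add: F)
    also have "\<dots> = inverse F * (1 - e)" by (simp add: e_def algebra_simps)
    finally have G: "inverse F * (1 - e) = G" by simp
    have "1 + e = 2 - F * G" by (simp add: e_def)
    then have "G * (2 - F * G) = inverse F * (1 - e) * (1 + e)" by (simp only: G)
    then show ?thesis by (simp add: algebra_simps)
  qed
  ultimately show ?thesis by simp
qed

text \<open>
  One Newton step from precision \<open>n div 2\<close> to precision \<open>n\<close> costs \<open>2 M(n) + n + 1 \<le> 3 M(n)\<close>. By
  superlinearity the previous steps together cost at most \<open>6 M(n div 2) \<le> 3 M(n)\<close>, so the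
  bound \<open>6 M(n)\<close> reproduces itself. The recursion starts at precision \<open>0\<close>, where the inverse is the
  constant \<open>1\<close>.
\<close>

lemma slp_inverse:
  assumes super: "\<And>n. n \<ge> 1 \<Longrightarrow> mult_cost (2 * n) \<ge> 2 * mult_cost n"
    and "\<And>x. F x $ 0 = 1"
  shows "slp (coefs n F) (6 * mult_cost n) (coefs n (\<lambda>x. inverse (F x)))"
proof (induction n rule: less_induct)
  case (less n)
  let ?I = "\<lambda>x. inverse (F x)"
  have base: "slp A s (coefs 0 ?I)" for A s
    by (rule slp_weaken[OF slp_leaves[OF coefs_subsetI]]) (use assms(2) in auto)
  show ?case
  proof (cases "n = 0")
    case True
    then show ?thesis using base by simp
  next
    case False
    define m where "m = n div 2"
    \<comment> \<open>\<open>G\<close> is what the recursive call provides, \<open>G * K\<close> the refined inverse\<close>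
    define G where "G = (\<lambda>x. fps_cutoff (Suc m) (?I x))"
    define H where "H = (\<lambda>x. F x * G x)"
    define K where "K = (\<lambda>x. 2 - H x)"
    let ?A = "coefs n F"
    have m: "m < n" "n < 2 * Suc m" using False by (auto simp: m_def)
    have G: "coefs n G \<subseteq> leaves (coefs m ?I \<union> B)" for B
    proof (rule coefs_subsetI)
      fix k
      have "(\<lambda>x. G x $ k) = (if k \<le> m then \<lambda>x. ?I x $ k else (\<lambda>_. 0))"
        by (auto simp: G_def fun_eq_iff)
      then show "(\<lambda>x. G x $ k) \<in> leaves (coefs m ?I \<union> B)"
        using coefsI[of k m ?I] by (auto simp: leaves_def)
    qed
    have Gs: "coefs n G \<subseteq> leaves (?A \<union> (coefs m ?I \<union> B))" for B
      using G[of "?A \<union> B"] by (simp add: Un_ac)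
    have F: "coefs n F \<subseteq> leaves (coefs n F \<union> B)" for B by (auto simp: leaves_def)
    have "slp ?A (3 * mult_cost n) (coefs m ?I)"
    proof (cases "m = 0")
      case True
      then show ?thesis using base by simp
    next
      case False
      then have "2 * mult_cost m \<le> mult_cost (2 * m)" using super[of m] by simp
      also have "\<dots> \<le> mult_cost n" by (rule mult_cost_mono) (simp add: m_def)
      finally have "6 * mult_cost m \<le> 3 * mult_cost n" by simp
      moreover have "slp ?A (6 * mult_cost m) (coefs m ?I)"
        by (rule slp_mono[OF less.IH[OF m(1)]]) (use m(1) in \<open>auto simp: coefs_def\<close>)
      ultimately show ?thesis by (auto intro: slp_weaken)
    qed
    from slp_continue[OF this slp_mult[OF F Gs[of "{}", simplified]]]
    have 1: "slp ?A (3 * mult_cost n + mult_cost n) (coefs m ?I \<union> coefs n H)"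
      by (simp add: H_def subset_leaves)
    have "slp (?A \<union> (coefs m ?I \<union> coefs n H)) (Suc n) (coefs n K)"
      unfolding K_def
    proof (rule slp_coefs_diff)
      show "coefs n (\<lambda>x. 2) \<subseteq> leaves (?A \<union> (coefs m ?I \<union> coefs n H))" by (auto simp: coefs_def)
    qed (auto simp: leaves_def)
    from slp_continue[OF 1 this]
    have 2: "slp ?A (3 * mult_cost n + mult_cost n + Suc n) (coefs m ?I \<union> coefs n H \<union> coefs n K)"
      by (simp add: subset_leaves)
    have "slp (?A \<union> (coefs m ?I \<union> coefs n H \<union> coefs n K)) (mult_cost n) (coefs n (\<lambda>x. G x * K x))"
      by (rule slp_mult) (use Gs[of "coefs n H \<union> coefs n K"] in \<open>auto simp: leaves_def Un_ac\<close>)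
    from slp_continue[OF 2 this]
    have "slp ?A (3 * mult_cost n + mult_cost n + Suc n + mult_cost n)
        (coefs m ?I \<union> coefs n H \<union> coefs n K \<union> coefs n (\<lambda>x. G x * K x))"
      by (simp add: subset_leaves)
    moreover have "coefs n (\<lambda>x. G x * K x) = coefs n ?I"
      by (rule coefs_cong)
        (use m(2) assms(2) in \<open>auto simp: G_def K_def H_def intro!: newton_step\<close>)
    ultimately show ?thesis using mult_cost_ge[of n] by (auto intro: slp_weaken)
  qed
qed

section \<open>Cumulants from products\<close>

text \<open>
  The moment generating function of the inputs of the cumulant problem, with \<open>x i\<close> standing for the
  moment of order \<open>i + 1\<close>.
\<close>

definition trunc_mgf :: "nat \<Rightarrow> (nat \<Rightarrow> complex) \<Rightarrow> complex fps" where
  "trunc_mgf n x = mgf (moment (map x [0..<n]))"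

lemma trunc_mgf_nth:
  "trunc_mgf n x $ k = (if k = 0 then 1 else if k \<le> n then x (k - 1) / fact k else 0)"
  by (cases k) (auto simp: trunc_mgf_def mgf_def moment_def nth_default_def)

lemma length_cumulant_problem [simp]: "length (cumulant_problem n ms) = n"
  by (simp add: cumulant_problem_def)

lemma cumulant_problem_nth:
  assumes "k < n"
  shows "cumulant_problem n (map x [0..<n]) ! k =
    fact (Suc k) * (fps_ln 1 oo (trunc_mgf n x - 1)) $ Suc k"
  using assms by (simp add: cumulant_problem_def cumulant_def trunc_mgf_def del: upt_Suc fact_Suc)

lemma fps_deriv_ln_compose:
  fixes F :: "complex fps"
  assumes "F $ 0 = 1"
  shows "fps_deriv (fps_ln 1 oo (F - 1)) = fps_deriv F * inverse F"
proof -
  have 0: "(F - 1) $ 0 = 0" using assms by simp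
  have "(1 + fps_X) oo (F - 1) = F"
    using 0 by (simp add: fps_compose_add_distrib fps_X_fps_compose_startby0)
  then have "inverse (1 + fps_X) oo (F - 1) = inverse F"
    using fps_inverse_compose[OF 0, of "1 + fps_X"] by simp
  then show ?thesis
    unfolding fps_compose_deriv[OF 0] fps_ln_deriv by (simp add: mult.commute)
qed

text \<open>
  Integration divides the coefficient of \<open>t\<^sup>k\<close> by \<open>k + 1\<close>, which turns the factor \<open>(k + 1)!\<close> in the definition
  of the cumulant into \<open>k!\<close>.
\<close>

lemma cumulant_problem_nth_deriv:
  assumes "k < n"
  shows "cumulant_problem n (map x [0..<n]) ! k =
    fact k * (fps_deriv (trunc_mgf n x) * inverse (trunc_mgf n x)) $ k"
proof -
  have "trunc_mgf n x $ 0 = 1" by (simp add: trunc_mgf_nth)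
  from fps_deriv_ln_compose[OF this, symmetric] show ?thesis
    unfolding cumulant_problem_nth[OF assms] by (simp add: fps_deriv_nth)
qed

text \<open>
  The inverse costs \<open>6 M(n)\<close>, the product with the derivative \<open>M(n)\<close>, and scaling the inputs for the two
  series and the outputs at most \<open>3 (n + 1) \<le> 3 M(n)\<close>.
\<close>

lemma slp_cumulants:
  assumes super: "\<And>n. n \<ge> 1 \<Longrightarrow> mult_cost (2 * n) \<ge> 2 * mult_cost n"
  shows "slp ((\<lambda>i x. x i) ` {..<n}) (10 * mult_cost n)
    ((\<lambda>k x. cumulant_problem n (map x [0..<n]) ! k) ` {..<n})"
proof -
  let ?A = "(\<lambda>i x. x i) ` {..<n} :: ((nat \<Rightarrow> complex) \<Rightarrow> complex) set"
  let ?F = "trunc_mgf n" let ?D = "\<lambda>x. fps_deriv (trunc_mgf n x)"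
  let ?I = "\<lambda>x. inverse (trunc_mgf n x)"
  have input: "(\<lambda>x. x i) \<in> leaves ?A" if "i < n" for i
    using that by (auto simp: leaves_def)
  have scaled: "\<exists>f\<in>leaves ?A. \<exists>g\<in>leaves ?A. (\<lambda>x. c * f' x) \<in> gate_results f g"
    if "f' \<in> leaves ?A" for c f'
    by (rule bexI[of _ "\<lambda>_. c"], rule bexI[of _ f']) (use that in \<open>auto simp: gate_results_def\<close>)
  have F: "slp ?A (Suc n) (coefs n ?F)"
  proof (rule slp_coefs)
    fix k assume "k \<le> n"
    then have eq: "(\<lambda>x. ?F x $ k) = (\<lambda>x. 1 / fact k * (if k = 0 then (\<lambda>_. 1) else (\<lambda>x. x (k - 1))) x)"
      by (auto simp: trunc_mgf_nth)
    show "\<exists>f\<in>leaves ?A. \<exists>g\<in>leaves ?A. (\<lambda>x. ?F x $ k) \<in> gate_results f g"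
      unfolding eq by (rule scaled) (use \<open>k \<le> n\<close> input in auto)
  qed
  have D: "slp ?A (Suc n) (coefs n ?D)"
  proof (rule slp_coefs)
    fix k assume "k \<le> n"
    have eq: "(\<lambda>x. ?D x $ k) = (\<lambda>x. 1 / fact k * (if k < n then (\<lambda>x. x k) else (\<lambda>_. 0)) x)"
      by (auto simp: trunc_mgf_nth fun_eq_iff field_simps simp del: of_nat_Suc)
    show "\<exists>f\<in>leaves ?A. \<exists>g\<in>leaves ?A. (\<lambda>x. ?D x $ k) \<in> gate_results f g"
      unfolding eq by (rule scaled) (use input in auto)
  qed
  have I: "slp (coefs n ?F) (6 * mult_cost n) (coefs n ?I)"
    by (rule slp_inverse[OF super]) (auto simp: trunc_mgf_nth)
  have P: "slp (coefs n ?D \<union> coefs n ?I) (mult_cost n) (coefs n (\<lambda>x. ?D x * ?I x))"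
    by (rule slp_mult) (auto simp: leaves_def)
  have "slp (coefs n (\<lambda>x. ?D x * ?I x)) (card {..<n})
      ((\<lambda>k x. cumulant_problem n (map x [0..<n]) ! k) ` {..<n})"
  proof (rule slp_family)
    fix k assume k: "k \<in> {..<n}"
    then have eq: "(\<lambda>x. cumulant_problem n (map x [0..<n]) ! k) = (\<lambda>x. fact k * (?D x * ?I x) $ k)"
      by (auto simp: cumulant_problem_nth_deriv)
    show "\<exists>f\<in>leaves (coefs n (\<lambda>x. ?D x * ?I x)). \<exists>g\<in>leaves (coefs n (\<lambda>x. ?D x * ?I x)).
        (\<lambda>x. cumulant_problem n (map x [0..<n]) ! k) \<in> gate_results f g"
      unfolding eq
      by (rule bexI[of _ "\<lambda>_. fact k"], rule bexI[of _ "\<lambda>x. (?D x * ?I x) $ k"])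
        (use k subset_leaves in \<open>auto simp: gate_results_def intro!: subsetD[OF subset_leaves] coefsI\<close>)
  qed simp
  from slp_trans[OF slp_trans[OF slp_Un[OF D slp_trans[OF F I]] P] this]
  show ?thesis by (rule slp_weaken) (use mult_cost_ge[of n] in auto)
qed

lemma cumulant_cost_le:
  assumes "\<And>n. n \<ge> 1 \<Longrightarrow> mult_cost (2 * n) \<ge> 2 * mult_cost n"
  shows "arith_complexity n (cumulant_problem n) \<le> 10 * mult_cost n"
  by (rule arith_complexity_le[OF slp_cumulants[OF assms] length_cumulant_problem])

section \<open>Products from cumulants\<close>

text \<open>
  The restriction of \<open>f\<close> to the line through \<open>0\<close> and \<open>x\<close> is a polynomial in the parameter \<open>\<epsilon>\<close> whose first
  three coefficients are \<open>c\<close>, \<open>l x\<close> and \<open>q x\<close>; these are the homogeneous parts of \<open>f\<close> of degree \<open>0\<close>, \<open>1\<close>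
  and \<open>2\<close>. The first one has to be the same for all \<open>x\<close>, so that it can be a constant in a circuit.
\<close>

definition jet ::
  "((nat \<Rightarrow> complex) \<Rightarrow> complex) \<Rightarrow> complex \<Rightarrow>
    ((nat \<Rightarrow> complex) \<Rightarrow> complex) \<Rightarrow> ((nat \<Rightarrow> complex) \<Rightarrow> complex) \<Rightarrow> bool"
where
  "jet f c l q \<longleftrightarrow> (\<exists>P :: (nat \<Rightarrow> complex) \<Rightarrow> complex poly.
     \<forall>x. (\<forall>\<epsilon>. f (\<lambda>i. \<epsilon> * x i) = poly (P x) \<epsilon>) \<and>
         coeff (P x) 0 = c \<and> coeff (P x) 1 = l x \<and> coeff (P x) 2 = q x)"

lemma jet_const: "jet (\<lambda>_. c) c (\<lambda>_. 0) (\<lambda>_. 0)"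
  unfolding jet_def by (intro exI[of _ "\<lambda>_. [:c:]"]) (auto simp: numeral_2_eq_2)

lemma jet_input: "jet (\<lambda>x. x i) 0 (\<lambda>x. x i) (\<lambda>_. 0)"
  unfolding jet_def by (intro exI[of _ "\<lambda>x. [:0, x i:]"]) (auto simp: numeral_2_eq_2)

lemma jet_add:
  assumes "jet f c l q" "jet f' c' l' q'"
  shows "jet (\<lambda>x. f x + f' x) (c + c') (\<lambda>x. l x + l' x) (\<lambda>x. q x + q' x)"
proof -
  from assms obtain P P' where
    "\<forall>x. (\<forall>\<epsilon>. f (\<lambda>i. \<epsilon> * x i) = poly (P x) \<epsilon>) \<and>
         coeff (P x) 0 = c \<and> coeff (P x) 1 = l x \<and> coeff (P x) 2 = q x"
    "\<forall>x. (\<forall>\<epsilon>. f' (\<lambda>i. \<epsilon> * x i) = poly (P' x) \<epsilon>) \<and>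
         coeff (P' x) 0 = c' \<and> coeff (P' x) 1 = l' x \<and> coeff (P' x) 2 = q' x"
    unfolding jet_def by (elim exE)
  then show ?thesis unfolding jet_def by (intro exI[of _ "\<lambda>x. P x + P' x"]) auto
qed

lemma jet_diff:
  assumes "jet f c l q" "jet f' c' l' q'"
  shows "jet (\<lambda>x. f x - f' x) (c - c') (\<lambda>x. l x - l' x) (\<lambda>x. q x - q' x)"
proof -
  from assms obtain P P' where
    "\<forall>x. (\<forall>\<epsilon>. f (\<lambda>i. \<epsilon> * x i) = poly (P x) \<epsilon>) \<and>
         coeff (P x) 0 = c \<and> coeff (P x) 1 = l x \<and> coeff (P x) 2 = q x"
    "\<forall>x. (\<forall>\<epsilon>. f' (\<lambda>i. \<epsilon> * x i) = poly (P' x) \<epsilon>) \<and>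
         coeff (P' x) 0 = c' \<and> coeff (P' x) 1 = l' x \<and> coeff (P' x) 2 = q' x"
    unfolding jet_def by (elim exE)
  then show ?thesis unfolding jet_def by (intro exI[of _ "\<lambda>x. P x - P' x"]) auto
qed

lemma jet_mult:
  assumes "jet f c l q" "jet f' c' l' q'"
  shows "jet (\<lambda>x. f x * f' x) (c * c') (\<lambda>x. c * l' x + c' * l x)
    (\<lambda>x. (c * q' x + c' * q x) + l x * l' x)"
proof -
  from assms obtain P P' where
    "\<forall>x. (\<forall>\<epsilon>. f (\<lambda>i. \<epsilon> * x i) = poly (P x) \<epsilon>) \<and>
         coeff (P x) 0 = c \<and> coeff (P x) 1 = l x \<and> coeff (P x) 2 = q x"
    "\<forall>x. (\<forall>\<epsilon>. f' (\<lambda>i. \<epsilon> * x i) = poly (P' x) \<epsilon>) \<and>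
         coeff (P' x) 0 = c' \<and> coeff (P' x) 1 = l' x \<and> coeff (P' x) 2 = q' x"
    unfolding jet_def by (elim exE)
  then show ?thesis unfolding jet_def
    by (intro exI[of _ "\<lambda>x. P x * P' x"]) (auto simp: coeff_mult numeral_2_eq_2 algebra_simps)
qed

text \<open>
  The jet depends only on the function and not on the circuit computing it, because a complex
  polynomial is determined by its values.
\<close>

lemma jet_unique:
  assumes "jet f c l q" "jet f c' l' q'"
  shows "q = q'"
proof
  fix x
  from assms obtain P P' where
    P: "\<forall>x. (\<forall>\<epsilon>. f (\<lambda>i. \<epsilon> * x i) = poly (P x) \<epsilon>) \<and>
         coeff (P x) 0 = c \<and> coeff (P x) 1 = l x \<and> coeff (P x) 2 = q x"
    "\<forall>x. (\<forall>\<epsilon>. f (\<lambda>i. \<epsilon> * x i) = poly (P' x) \<epsilon>) \<and>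
         coeff (P' x) 0 = c' \<and> coeff (P' x) 1 = l' x \<and> coeff (P' x) 2 = q' x"
    unfolding jet_def by (elim exE)
  then have "poly (P x) = poly (P' x)" by (intro ext) metis
  then have "P x = P' x" by (simp add: poly_eq_poly_eq_iff)
  then show "q x = q' x" using P by metis
qed

text \<open>
  Each gate is replaced by gates for the linear and quadratic parts of its value. A multiplication is
  the worst case: the linear part \<open>c l' + c' l\<close> takes three gates and the quadratic part
  \<open>(c q' + c' q) + l l'\<close> takes five. The constant parts are known in advance and free.
\<close>

lemma slp_jets:
  assumes "slp ((\<lambda>i x. x i) ` {..<m}) s B"
  shows "\<exists>D. slp ((\<lambda>i x. x i) ` {..<m}) (8 * s) D \<and>
    (\<forall>f\<in>B. \<exists>c l q. jet f c l q \<and> l \<in> D \<and> q \<in> D)"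
  using assms
proof (induction rule: slp.induct)
  case (slp_leaves B)
  let ?A = "(\<lambda>i x. x i) ` {..<m} :: ((nat \<Rightarrow> complex) \<Rightarrow> complex) set"
  have "\<exists>c l q. jet f c l q \<and> l \<in> leaves ?A \<and> q \<in> leaves ?A" if f: "f \<in> B" for f
  proof -
    from f slp_leaves consider i where "i < m" "f = (\<lambda>x. x i)" | c where "f = (\<lambda>_. c)"
      by (auto simp: leaves_def)
    then show ?thesis
    proof cases
      case (1 i)
      then show ?thesis using jet_input[of i]
        by (intro exI[of _ 0] exI[of _ "\<lambda>x. x i"] exI[of _ "\<lambda>_. 0"]) (auto simp: leaves_def)
    next
      case (2 c) then show ?thesis using jet_const[of c] by (metis const_in_leaves)
    qed
  qed
  then show ?case by (intro exI[of _ "leaves ?A"]) (auto intro: slp.slp_leaves)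
next
  case (slp_gate s B f g h)
  let ?A = "(\<lambda>i x. x i) ` {..<m} :: ((nat \<Rightarrow> complex) \<Rightarrow> complex) set"
  obtain D where D: "slp ?A (8 * s) D" "\<forall>f\<in>B. \<exists>c l q. jet f c l q \<and> l \<in> D \<and> q \<in> D"
    using slp_gate.IH by blast
  obtain c l q where f: "jet f c l q" "l \<in> D" "q \<in> D" using D(2) slp_gate.hyps(2) by blast
  obtain c' l' q' where g: "jet g c' l' q'" "l' \<in> D" "q' \<in> D" using D(2) slp_gate.hyps(3) by blast
  have gate: "slp D 1 {h}" if "a \<in> leaves D" "b \<in> leaves D" "h \<in> gate_results a b" for a b h
    using slp_family[of "{()}" D "\<lambda>_. h"] that by auto
  have prod: "slp D 3 {\<lambda>x. c * v x + c' * u x}" if "u \<in> leaves D" "v \<in> leaves D" for u v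
  proof -
    have "slp D 2 {\<lambda>x. c * v x, \<lambda>x. c' * u x}"
      using slp_Un[OF gate[of "\<lambda>_. c" v "\<lambda>x. c * v x"] gate[of "\<lambda>_. c'" u "\<lambda>x. c' * u x"]] that
      by (simp add: gate_results_def insert_commute numeral_2_eq_2)
    moreover have "slp {\<lambda>x. c * v x, \<lambda>x. c' * u x} (card {()}) ((\<lambda>_ x. c * v x + c' * u x) ` {()})"
      by (rule slp_family) (auto simp: leaves_def gate_results_def)
    ultimately show ?thesis using slp_trans[of D 2 _ 1] by simp
  qed
  obtain c1 l1 q1 where h: "jet h c1 l1 q1" "slp D 8 {l1, q1}"
  proof -
    from slp_gate.hyps(4) consider "h = (\<lambda>x. f x + g x)" | "h = (\<lambda>x. f x - g x)" | "h = (\<lambda>x. f x * g x)"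
      by (auto simp: gate_results_def)
    then show ?thesis
    proof cases
      case 1
      have "slp D (1 + 1) ({\<lambda>x. l x + l' x} \<union> {\<lambda>x. q x + q' x})"
        by (intro slp_Un gate[of l l'] gate[of q q'])
          (use f g subset_leaves in \<open>auto simp: gate_results_def\<close>)
      then have "slp D 8 {\<lambda>x. l x + l' x, \<lambda>x. q x + q' x}" by (rule slp_weaken) auto
      then show ?thesis using that jet_add[OF f(1) g(1)] 1 by blast
    next
      case 2
      have "slp D (1 + 1) ({\<lambda>x. l x - l' x} \<union> {\<lambda>x. q x - q' x})"
        by (intro slp_Un gate[of l l'] gate[of q q'])
          (use f g subset_leaves in \<open>auto simp: gate_results_def\<close>)
      then have "slp D 8 {\<lambda>x. l x - l' x, \<lambda>x. q x - q' x}" by (rule slp_weaken) auto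
      then show ?thesis using that jet_diff[OF f(1) g(1)] 2 by blast
    next
      case 3
      let ?u = "\<lambda>x. c * q' x + c' * q x" let ?v = "\<lambda>x. l x * l' x"
      have in_leaves: "l \<in> leaves D" "l' \<in> leaves D" "q \<in> leaves D" "q' \<in> leaves D"
        using f g subset_leaves by blast+
      have "slp D (3 + 1) ({?u} \<union> {?v})"
        by (intro slp_Un prod gate[of l l'])
          (use in_leaves in \<open>auto simp: gate_results_def\<close>)
      moreover have "slp ({?u} \<union> {?v}) (card {()}) ((\<lambda>_ x. ?u x + ?v x) ` {()})"
        by (rule slp_family) (auto simp: leaves_def gate_results_def)
      ultimately have "slp D (3 + 1 + card {()}) ((\<lambda>_ x. ?u x + ?v x) ` {()})"
        by (rule slp_trans)
      with prod[OF in_leaves(1,2)]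
      have "slp D (3 + (3 + 1 + card {()})) ({\<lambda>x. c * l' x + c' * l x} \<union> (\<lambda>_ x. ?u x + ?v x) ` {()})"
        by (rule slp_Un)
      then have "slp D 8 {\<lambda>x. c * l' x + c' * l x, \<lambda>x. ?u x + ?v x}" by (rule slp_weaken) auto
      then show ?thesis using that jet_mult[OF f(1) g(1)] 3 by blast
    qed
  qed
  have "slp ?A (8 * s + 8) (D \<union> {l1, q1})" by (rule slp_extend[OF h(2) D(1)])
  moreover have "\<forall>f\<in>insert h B. \<exists>c l q. jet f c l q \<and> l \<in> D \<union> {l1, q1} \<and> q \<in> D \<union> {l1, q1}"
    using D(2) h(1) by blast
  ultimately show ?case by (intro exI[of _ "D \<union> {l1, q1}"]) (simp add: add.commute)
next
  case (slp_weaken s B C t)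
  then show ?case by (meson mult_le_mono2 order_refl slp.slp_weaken subsetD)
qed

text \<open>
  The moment series minus its constant term is linear in the moments, so scaling them by \<open>\<epsilon>\<close> turns the
  \<open>i\<close>-th summand of the logarithm into \<open>\<epsilon>\<^sup>i\<close> times itself. The quadratic part is the summand for \<open>i = 2\<close>,
  whose coefficient in \<open>log (1 + t)\<close> is \<open>-1/2\<close>.
\<close>

lemma jet_cumulant:
  assumes "k < n"
  shows "\<exists>c l. jet (\<lambda>x. cumulant_problem n (map x [0..<n]) ! k) c l
    (\<lambda>x. - fact (Suc k) / 2 * ((trunc_mgf n x - 1)\<^sup>2) $ Suc k)"
proof -
  let ?a = "\<lambda>x i. fact (Suc k) * (fps_ln 1 $ i * ((trunc_mgf n x - 1) ^ i) $ Suc k)"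
  let ?P = "\<lambda>x. \<Sum>i=0..Suc k. monom (?a x i) i"
  have scale: "trunc_mgf n (\<lambda>i. \<epsilon> * x i) - 1 = fps_const \<epsilon> * (trunc_mgf n x - 1)" for \<epsilon> x
    by (auto simp: fps_eq_iff trunc_mgf_nth)
  have "cumulant_problem n (map (\<lambda>i. \<epsilon> * x i) [0..<n]) ! k = poly (?P x) \<epsilon>" for \<epsilon> x
    unfolding cumulant_problem_nth[OF assms] scale fps_compose_nth
    by (simp add: power_mult_distrib poly_sum poly_monom sum_distrib_left mult_ac fps_const_power
        del: fact_Suc sum.cl_ivl_Suc power_Suc)
  moreover have coeff_P: "coeff (?P x) j = (if j \<le> Suc k then ?a x j else 0)" for x j
    by (simp add: coeff_sum coeff_monom del: fact_Suc power_Suc sum.cl_ivl_Suc)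
  moreover have "coeff (?P x) 2 = - fact (Suc k) / 2 * ((trunc_mgf n x - 1)\<^sup>2) $ Suc k" for x
  proof (cases "k = 0")
    \<comment> \<open>the first cumulant is linear: the sum stops at \<open>i = 1\<close>, and so the square has to vanish there\<close>
    case True
    have "((trunc_mgf n x - 1)\<^sup>2) $ Suc 0 = 0"
      by (simp add: power2_eq_square trunc_mgf_nth)
    then show ?thesis unfolding coeff_P using True by simp
  next
    case False
    then show ?thesis unfolding coeff_P by (simp add: fps_ln_nth del: fact_Suc)
  qed
  moreover have "coeff (?P x) 0 = 0" for x unfolding coeff_P by simp
  ultimately show ?thesis unfolding jet_def
    by (intro exI[of _ "0"] exI[of _ "\<lambda>x. coeff (?P x) 1"] exI[of _ ?P]) blast
qed

text \<open>
  The coefficients of \<open>F\<close>, multiplied by factorials, are used as moments. The quadratic parts of the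
  cumulants are then the coefficients of \<open>F\<^sup>2\<close> up to known nonzero factors. A moment series has no free
  constant term, which is why that of \<open>F\<close> has to be zero.
\<close>

lemma slp_square:
  assumes super: "\<And>n. n \<ge> 1 \<Longrightarrow> mult_cost (2 * n) \<ge> 2 * mult_cost n"
    and F0: "\<And>x. F x $ 0 = 0"
  shows "slp (coefs n F) (8 * arith_complexity n (cumulant_problem n) + 2 * n)
    (coefs n (\<lambda>x. F x * F x))"
proof -
  let ?L = "arith_complexity n (cumulant_problem n)"
  let ?A = "(\<lambda>i x. x i) ` {..<n} :: ((nat \<Rightarrow> complex) \<Rightarrow> complex) set"
  let ?C = "\<lambda>k x. cumulant_problem n (map x [0..<n]) ! k"
  let ?q = "\<lambda>k x. - fact (Suc k) / 2 * ((trunc_mgf n x - 1)\<^sup>2) $ Suc k"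
  let ?\<phi> = "\<lambda>x i. fact (Suc i) * F x $ Suc i"
  have "slp ?A ?L (?C ` {..<n})"
    by (rule slp_arith_complexity[OF slp_cumulants[OF super] length_cumulant_problem])
  from slp_jets[OF this] obtain D where D: "slp ?A (8 * ?L) D"
    "\<And>k. k < n \<Longrightarrow> \<exists>c l q. jet (?C k) c l q \<and> l \<in> D \<and> q \<in> D"
    by auto
  have "?q k \<in> D" if "k < n" for k
    using D(2)[OF that] jet_cumulant[OF that] jet_unique by metis
  then have "slp ?A (8 * ?L) (?q ` {..<n})"
    by (intro slp_weaken[OF D(1)]) auto
  from slp_substitute[OF this, of ?\<phi>]
  have q: "slp ((\<lambda>i x. ?\<phi> x i) ` {..<n}) (8 * ?L) ((\<lambda>k x. ?q k (?\<phi> x)) ` {..<n})"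
    by (simp only: image_image)
  have in_F: "(\<lambda>x. F x $ Suc i) \<in> leaves (coefs n F)" if "i < n" for i
    using coefsI[of "Suc i" n F] subset_leaves that by auto
  have pre: "slp (coefs n F) (card {..<n}) ((\<lambda>i x. ?\<phi> x i) ` {..<n})"
  proof (rule slp_family)
    fix i assume "i \<in> {..<n}"
    then show "\<exists>f\<in>leaves (coefs n F). \<exists>g\<in>leaves (coefs n F). (\<lambda>x. ?\<phi> x i) \<in> gate_results f g"
      by (intro bexI[of _ "\<lambda>_. fact (Suc i)"] bexI[of _ "\<lambda>x. F x $ Suc i"])
        (auto simp: gate_results_def in_F simp del: fact_Suc)
  qed simp
  have mgf: "(trunc_mgf n (?\<phi> x) - 1) $ k = F x $ k" if "k \<le> n" for x k
    using that F0 by (cases k) (auto simp: trunc_mgf_nth simp del: fact_Suc)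
  have sq: "?q k (?\<phi> x) = - fact (Suc k) / 2 * (F x * F x) $ Suc k" if "k < n" for k x
  proof -
    have "((trunc_mgf n (?\<phi> x) - 1)\<^sup>2) $ Suc k = (F x * F x) $ Suc k"
      unfolding power2_eq_square fps_mult_nth
    proof (rule sum.cong[OF refl])
      fix i assume "i \<in> {0..Suc k}"
      then have "i \<le> n" "Suc k - i \<le> n" using that by auto
      then show "(trunc_mgf n (?\<phi> x) - 1) $ i * (trunc_mgf n (?\<phi> x) - 1) $ (Suc k - i)
          = F x $ i * F x $ (Suc k - i)"
        by (simp only: mgf)
    qed
    then show ?thesis by (simp only:)
  qed
  let ?Q = "(\<lambda>k x. ?q k (?\<phi> x)) ` {..<n}"
  have post: "slp ?Q (card {..<n}) ((\<lambda>k x. (F x * F x) $ Suc k) ` {..<n})"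
  proof (rule slp_family)
    fix k assume k: "k \<in> {..<n}"
    have "(F x * F x) $ Suc k = - 2 / fact (Suc k) * ?q k (?\<phi> x)" for x
      unfolding sq[OF k[unfolded lessThan_iff]] by (simp del: fact_Suc)
    then show "\<exists>f\<in>leaves ?Q. \<exists>g\<in>leaves ?Q. (\<lambda>x. (F x * F x) $ Suc k) \<in> gate_results f g"
      by (intro bexI[of _ "\<lambda>_. - 2 / fact (Suc k)"] bexI[of _ "\<lambda>x. ?q k (?\<phi> x)"])
        (use k in \<open>auto simp: gate_results_def leaves_def\<close>)
  qed simp
  have "slp (coefs n F) (n + 8 * ?L + n) ((\<lambda>k x. (F x * F x) $ Suc k) ` {..<n})"
    using slp_trans[OF slp_trans[OF pre q] post] by simp
  from slp_with_leaves[OF this] show ?thesis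
  proof (rule slp_weaken)
    show "coefs n (\<lambda>x. F x * F x) \<subseteq>
        leaves (coefs n F \<union> (\<lambda>k x. (F x * F x) $ Suc k) ` {..<n})"
    proof (rule coefs_subsetI)
      fix k assume "k \<le> n"
      then show "(\<lambda>x. (F x * F x) $ k) \<in>
          leaves (coefs n F \<union> (\<lambda>k x. (F x * F x) $ Suc k) ` {..<n})"
        by (cases k) (auto simp: leaves_def F0)
    qed
  qed simp
qed

text \<open>
  When only the first moment \<open>c\<close> is nonzero, the \<open>k\<close>-th cumulant is a nonzero multiple of \<open>c\<^sup>k\<close>. Comparing
  \<open>c = 1\<close> with \<open>c = 2\<close> shows that the cumulants are distinct, and for \<open>k \<ge> 2\<close> they are not constants or
  inputs. The first cumulant is an input, hence the \<open>+ 1\<close>.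
\<close>

lemma cumulant_cost_ge:
  assumes super: "\<And>n. n \<ge> 1 \<Longrightarrow> mult_cost (2 * n) \<ge> 2 * mult_cost n"
  shows "n \<le> arith_complexity n (cumulant_problem n) + 1"
proof -
  let ?A = "(\<lambda>i x. x i) ` {..<n} :: ((nat \<Rightarrow> complex) \<Rightarrow> complex) set"
  let ?C = "\<lambda>k x. cumulant_problem n (map x [0..<n]) ! k"
  let ?p = "\<lambda>c i. if i = 0 then c else 0 :: complex"
  have "slp ?A (arith_complexity n (cumulant_problem n)) (?C ` {..<n})"
    by (rule slp_arith_complexity[OF slp_cumulants[OF super] length_cumulant_problem])
  then have "slp ?A (arith_complexity n (cumulant_problem n)) (?C ` {1..<n})"
    by (rule slp_weaken) auto
  from card_le_slp[OF this]
  have le: "card (?C ` {1..<n} - leaves ?A) \<le> arith_complexity n (cumulant_problem n)" by simp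
  have C: "?C k (?p c) = fact (Suc k) * (fps_ln 1 $ Suc k) * c ^ Suc k" if "k < n" for k c
  proof -
    have T: "trunc_mgf n (?p c) - 1 = fps_const c * fps_X"
      using that by (auto simp: fps_eq_iff trunc_mgf_nth fps_X_def)
    show ?thesis unfolding cumulant_problem_nth[OF that] T fps_nth_compose_linear
      by (simp only: mult_ac)
  qed
  have double: "?C k (?p 2) = 2 ^ Suc k * ?C k (?p 1)" "?C k (?p 1) \<noteq> 0" if "k < n" for k
    unfolding C[OF that] by (simp_all add: fps_ln_nth del: of_nat_Suc fact_Suc)
  have "inj_on ?C {1..<n}"
  proof (rule inj_onI)
    fix j k assume jk: "j \<in> {1..<n}" "k \<in> {1..<n}" "?C j = ?C k"
    have "(2::complex) ^ Suc j * ?C k (?p 1) = 2 ^ Suc k * ?C k (?p 1)"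
      using double(1)[of j] double(1)[of k] jk(1,2)
      unfolding fun_cong[OF jk(3), of "?p 1"] fun_cong[OF jk(3), of "?p 2"] by auto
    then have "of_nat (2 ^ Suc j) = (of_nat (2 ^ Suc k) :: complex)"
      using double(2)[of k] jk(2) by simp
    then show "j = k" unfolding of_nat_eq_iff by simp
  qed
  moreover have "?C k \<notin> leaves ?A" if k: "k \<in> {1..<n}" for k
  proof
    assume "?C k \<in> leaves ?A"
    then consider i where "?C k = (\<lambda>x. x i)" | c where "?C k = (\<lambda>_. c)"
      by (auto simp: leaves_def)
    then obtain j where j: "j \<le> 1" "?C k (?p 2) = 2 ^ j * ?C k (?p 1)"
    proof cases
      case (1 i)
      show ?thesis by (rule that[of 1]) (simp_all add: fun_cong[OF 1])
    next
      case (2 c)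
      show ?thesis by (rule that[of 0]) (simp_all add: fun_cong[OF 2])
    qed
    then have "of_nat (2 ^ j) = (of_nat (2 ^ Suc k) :: complex)"
      using double[of k] k by simp
    then have "j = Suc k" unfolding of_nat_eq_iff
      using power_inject_exp[of "2::nat" j "Suc k"] by (simp del: power_Suc)
    then show False using j(1) k by simp
  qed
  then have "?C ` {1..<n} - leaves ?A = ?C ` {1..<n}" by blast
  ultimately show ?thesis using le by (simp add: card_image)
qed

text \<open>
  With the constant terms split off as \<open>F = F\<^sub>0 + a\<close> and \<open>G = G\<^sub>0 + b\<close>, the product is
  \<open>a b + F\<^sub>0 G + G\<^sub>0 a\<close>, and \<open>4 a b = (a + b)\<^sup>2 - (a - b)\<^sup>2\<close> costs two squarings.
\<close>

lemma slp_product_from_cumulants: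
  assumes super: "\<And>n. n \<ge> 1 \<Longrightarrow> mult_cost (2 * n) \<ge> 2 * mult_cost n"
  shows "slp (coefs n F \<union> coefs n G)
    (16 * arith_complexity n (cumulant_problem n) + 12 * Suc n) (coefs n (\<lambda>x. F x * G x))"
proof -
  let ?L = "8 * arith_complexity n (cumulant_problem n) + 2 * n"
  let ?A = "coefs n F \<union> coefs n G"
  define a where "a = (\<lambda>x. F x - fps_const (F x $ 0))"
  define b where "b = (\<lambda>x. G x - fps_const (G x $ 0))"
  define u where "u = (\<lambda>x. a x + b x)"
  define v where "v = (\<lambda>x. a x - b x)"
  define d where "d = (\<lambda>x. u x * u x - v x * v x)"
  define e where "e = (\<lambda>x. fps_const (1 / 4) * d x)"
  define f where "f = (\<lambda>x. fps_const (F x $ 0) * G x)"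
  define g where "g = (\<lambda>x. fps_const (G x $ 0) * a x)"
  define h where "h = (\<lambda>x. e x + f x)"
  have tail: "coefs n (\<lambda>x. H x - fps_const (H x $ 0)) \<subseteq> leaves A"
    if "coefs n H \<subseteq> A" for H :: "'a \<Rightarrow> complex fps" and A
  proof (rule coefs_subsetI)
    fix k assume "k \<le> n"
    then show "(\<lambda>x. (H x - fps_const (H x $ 0)) $ k) \<in> leaves A"
      using coefsI[of k n H] that by (cases k) (auto simp: leaves_def)
  qed
  have ab: "coefs n a \<subseteq> leaves ?A" "coefs n b \<subseteq> leaves ?A"
    unfolding a_def b_def by (rule tail; simp)+
  have G: "coefs n G \<subseteq> leaves ?A" by (auto simp: leaves_def)
  have F0: "(\<lambda>x. F x $ 0) \<in> leaves ?A" "(\<lambda>x. G x $ 0) \<in> leaves ?A"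
    using coefsI[of 0 n] by (auto simp: leaves_def)
  have u0: "u x $ 0 = 0" "v x $ 0 = 0" for x by (simp_all add: u_def v_def a_def b_def)
  have uu: "slp ?A (Suc n + ?L) (coefs n (\<lambda>x. u x * u x))"
    by (rule slp_trans[OF _ slp_square[OF super u0(1)]])
      (use slp_coefs_add[OF ab] in \<open>simp add: u_def\<close>)
  have vv: "slp ?A (Suc n + ?L) (coefs n (\<lambda>x. v x * v x))"
    by (rule slp_trans[OF _ slp_square[OF super u0(2)]])
      (use slp_coefs_diff[OF ab] in \<open>simp add: v_def\<close>)
  have d: "slp ?A (Suc n + ?L + (Suc n + ?L) + Suc n) (coefs n d)"
    unfolding d_def by (rule slp_trans[OF slp_Un[OF uu vv] slp_coefs_diff]) (auto simp: leaves_def)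
  have e: "slp ?A (Suc n + ?L + (Suc n + ?L) + Suc n + Suc n) (coefs n e)"
    unfolding e_def by (rule slp_trans[OF d slp_coefs_scale]) (auto simp: leaves_def)
  have f: "slp ?A (Suc n) (coefs n f)"
    unfolding f_def by (rule slp_coefs_scale[OF F0(1) G])
  have g: "slp ?A (Suc n) (coefs n g)"
    unfolding g_def by (rule slp_coefs_scale[OF F0(2) ab(1)])
  have h: "slp ?A (Suc n + ?L + (Suc n + ?L) + Suc n + Suc n + Suc n + Suc n) (coefs n h)"
    unfolding h_def by (rule slp_trans[OF slp_Un[OF e f] slp_coefs_add]) (auto simp: leaves_def)
  have "slp ?A (Suc n + ?L + (Suc n + ?L) + Suc n + Suc n + Suc n + Suc n + Suc n + Suc n)
      (coefs n (\<lambda>x. h x + g x))"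
    by (rule slp_trans[OF slp_Un[OF h g] slp_coefs_add]) (auto simp: leaves_def)
  moreover have "h x + g x = F x * G x" for x
  proof -
    have "d x = fps_const 4 * (a x * b x)"
      by (simp add: d_def u_def v_def algebra_simps flip: numeral_fps_const)
    then have "e x = a x * b x" by (simp add: e_def mult.assoc[symmetric])
    then show ?thesis by (simp add: h_def f_def g_def a_def b_def algebra_simps)
  qed
  ultimately show ?thesis by (auto intro: slp_weaken)
qed

lemma mult_cost_le_cumulant_cost:
  assumes super: "\<And>n. n \<ge> 1 \<Longrightarrow> mult_cost (2 * n) \<ge> 2 * mult_cost n"
  shows "mult_cost n \<le> 16 * arith_complexity n (cumulant_problem n) + 12 * Suc n"
proof -
  let ?A = "(\<lambda>i x. x i) ` {..<2 * Suc n} :: ((nat \<Rightarrow> complex) \<Rightarrow> complex) set"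
  let ?F = "\<lambda>x :: nat \<Rightarrow> complex. Abs_fps x"
  let ?G = "\<lambda>x :: nat \<Rightarrow> complex. Abs_fps (\<lambda>i. x (Suc n + i))"
  have "coefs n ?F \<union> coefs n ?G \<subseteq> leaves ?A"
    by (intro Un_least coefs_subsetI) (auto simp: leaves_def)
  from slp_from_leaves[OF slp_product_from_cumulants[OF super] this]
  have "slp ?A (16 * arith_complexity n (cumulant_problem n) + 12 * Suc n)
    (coefs n (\<lambda>x. ?F x * ?G x))" by simp
  moreover have "(\<lambda>x. mult_problem n (map x [0..<2 * Suc n]) ! k) = (\<lambda>x. (?F x * ?G x) $ k)"
    if "k < Suc n" for k
    by (rule ext, subst mult_problem_nth) (use that in \<open>auto simp: fps_mult_nth atLeast0AtMost\<close>)
  then have "(\<lambda>k x. mult_problem n (map x [0..<2 * Suc n]) ! k) ` {..<Suc n}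
      \<subseteq> coefs n (\<lambda>x. ?F x * ?G x)"
    using coefsI[of _ n "\<lambda>x. ?F x * ?G x"] by (auto simp del: upt_Suc)
  ultimately show ?thesis unfolding mult_cost_def
    by (intro arith_complexity_le[OF slp_weaken length_mult_problem]) auto
qed

section \<open>Counting set partitions\<close>

text \<open>
  The new element \<open>x\<close> joins the block \<open>b\<close> of \<open>Q\<close>. The choice \<open>b = {}\<close> stands for a block of its own: no
  partition contains the empty set, so the formula for the new partition is the same in both cases.
\<close>

lemma bij_betw_partition_insert:
  assumes "x \<notin> A"
  shows "bij_betw (\<lambda>(Q, b). insert (insert x b) (Q - {b}))
    (SIGMA Q:{Q. partition_on A Q}. insert {} Q) {P. partition_on (insert x A) P}"
proof -
  define block where "block P = (THE B. B \<in> P \<and> x \<in> B)" for P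
  let ?f = "\<lambda>(Q, b). insert (insert x b) (Q - {b})"
  let ?g = "\<lambda>P. (insert (block P - {x}) (P - {block P}) - {{}}, block P - {x})"
  let ?S = "SIGMA Q:{Q. partition_on A Q}. insert {} Q"
  let ?T = "{P. partition_on (insert x A) P}"
  have block: "block P \<in> P" "x \<in> block P" "block P - {x} \<notin> P" if "P \<in> ?T" for P
  proof -
    have P: "\<Union>P = insert x A" "disjoint P" "{} \<notin> P"
      using that by (auto simp: partition_on_def)
    obtain B where B: "B \<in> P" "x \<in> B" using P(1) by blast
    have "block P = B" unfolding block_def
    proof (rule the_equality)
      show "C = B" if "C \<in> P \<and> x \<in> C" for C
        using disjointD[OF P(2) _ B(1), of C] B(2) that by blast
    qed (use B in simp)
    moreover have "B - {x} \<notin> P"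
    proof
      assume *: "B - {x} \<in> P"
      moreover have "B - {x} \<noteq> B" using B(2) by blast
      ultimately have "(B - {x}) \<inter> B = {}" by (rule disjointD[OF P(2) _ B(1)])
      then have "B - {x} = {}" by blast
      with * P(3) show False by metis
    qed
    ultimately show "block P \<in> P" "x \<in> block P" "block P - {x} \<notin> P" using B by auto
  qed
  have left: "?g (?f p) = p" if p: "p \<in> ?S" for p
  proof -
    obtain Q b where p: "p = (Q, b)" and Q: "\<Union>Q = A" "{} \<notin> Q" "b = {} \<or> b \<in> Q"
      using p by (auto simp: partition_on_def)
    have x: "x \<notin> b" "insert x b \<notin> Q" "\<And>C. C \<in> Q \<Longrightarrow> x \<notin> C" using Q assms by auto
    have "block (insert (insert x b) (Q - {b})) = insert x b"
      unfolding block_def by (rule the_equality) (use x(3) in auto)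
    moreover have "insert x b - {x} = b" using x(1) by blast
    moreover have "insert (insert x b) (Q - {b}) - {insert x b} = Q - {b}" using x(2) by blast
    moreover have "insert b (Q - {b}) - {{}} = Q" using Q(2,3) by blast
    ultimately show ?thesis unfolding p by simp
  qed
  have right: "?f (?g P) = P" if P: "P \<in> ?T" for P
  proof -
    have "{} \<notin> P" using P by (auto simp: partition_on_def)
    moreover have "insert x (block P - {x}) = block P" using block(2)[OF P] by blast
    ultimately show ?thesis using block(1,3)[OF P] by auto
  qed
  have "?f ` ?S \<subseteq> ?T"
  proof
    fix P assume "P \<in> ?f ` ?S"
    then obtain Q b where Qb: "(Q, b) \<in> ?S" and P: "P = insert (insert x b) (Q - {b})" by auto
    have Q: "\<Union>Q = A" "disjoint Q" "{} \<notin> Q" "b = {} \<or> b \<in> Q"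
      using Qb by (auto simp: partition_on_def)
    have x: "\<And>C. C \<in> Q \<Longrightarrow> x \<notin> C" using Q(1) assms by auto
    have "b \<inter> C = {}" if "C \<in> Q" "C \<noteq> b" for C
      using disjointD[OF Q(2), of b C] Q(4) that by blast
    then have "insert x b \<inter> C = {}" if "C \<in> Q - {b}" for C using x that by auto
    then have "disjoint P"
      unfolding P using Q(2) by (simp add: disjoint_def Int_commute)
    moreover have "\<Union>P = insert x A" unfolding P using Q(1,4) by auto
    ultimately show "P \<in> ?T" using Q(3) unfolding P partition_on_def by auto
  qed
  moreover have "?g ` ?T \<subseteq> ?S"
  proof
    fix p assume "p \<in> ?g ` ?T"
    then obtain P where P: "P \<in> ?T" "p = ?g P" by blast
    have P': "\<Union>P = insert x A" "disjoint P" using P(1) by (auto simp: partition_on_def)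
    let ?Q = "insert (block P - {x}) (P - {block P}) - {{}}"
    have x: "x \<notin> C" if "C \<in> P - {block P}" for C
      using disjointD[OF P'(2), of "block P" C] block(1,2)[OF P(1)] that by blast
    have "\<Union>?Q = \<Union>P - {x}" using block(1)[OF P(1)] x by auto
    then have "\<Union>?Q = A" using P'(1) assms by auto
    moreover have "disjoint ?Q"
    proof -
      have "(block P - {x}) \<inter> C = {}" if "C \<in> P - {block P}" for C
        using disjointD[OF P'(2), of "block P" C] block(1)[OF P(1)] that by blast
      then have "disjoint (insert (block P - {x}) (P - {block P}))"
        using P'(2) by (simp add: disjoint_def Int_commute)
      then show ?thesis by (rule pairwise_subset) (rule Diff_subset)
    qed
    ultimately have "partition_on A ?Q" by (simp add: partition_on_def)
    then show "p \<in> ?S" unfolding P(2) by simp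
  qed
  ultimately show ?thesis
    by (intro bij_betw_byWitness[where f' = ?g] ballI left right)
qed

lemma sum_partitions_insert:
  fixes f :: "nat \<Rightarrow> nat"
  assumes "finite A" "x \<notin> A"
  shows "(\<Sum>P | partition_on (insert x A) P. f (card P)) =
    (\<Sum>Q | partition_on A Q. f (Suc (card Q)) + card Q * f (card Q))"
proof -
  let ?S = "SIGMA Q:{Q. partition_on A Q}. insert {} Q"
  have card: "card (insert (insert x b) (Q - {b})) = (if b = {} then Suc (card Q) else card Q)"
    if "partition_on A Q" "b \<in> insert {} Q" for Q b
  proof -
    have fin: "finite Q" using finite_elements[OF assms(1) that(1)] .
    have "insert x b \<notin> Q" "{} \<notin> Q" using that assms(2) by (auto simp: partition_on_def)
    moreover have "card Q > 0" if "b \<in> Q" using that fin by (auto simp: card_gt_0_iff)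
    ultimately show ?thesis using that fin by (auto simp: card_insert_if)
  qed
  have "(\<Sum>P | partition_on (insert x A) P. f (card P)) =
    (\<Sum>(Q, b)\<in>?S. f (card (insert (insert x b) (Q - {b}))))"
    using sum.reindex_bij_betw[OF bij_betw_partition_insert[OF assms(2)], of "\<lambda>P. f (card P)"]
    by (simp add: case_prod_unfold)
  also have "\<dots> = (\<Sum>Q | partition_on A Q. \<Sum>b\<in>insert {} Q. f (card (insert (insert x b) (Q - {b}))))"
    by (rule sum.Sigma[symmetric])
      (use finitely_many_partition_on[OF assms(1)] finite_elements[OF assms(1)] in auto)
  also have "\<dots> = (\<Sum>Q | partition_on A Q. f (Suc (card Q)) + card Q * f (card Q))"
  proof (rule sum.cong[OF refl])
    fix Q assume "Q \<in> {Q. partition_on A Q}"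
    then have Q: "partition_on A Q" by simp
    have fin: "finite Q" and "{} \<notin> Q"
      using finite_elements[OF assms(1) Q] Q by (auto simp: partition_on_def)
    have "(\<Sum>b\<in>insert {} Q. f (card (insert (insert x b) (Q - {b})))) =
      (\<Sum>b\<in>insert {} Q. f (if b = {} then Suc (card Q) else card Q))"
      by (rule sum.cong[OF refl]) (simp only: card[OF Q])
    also have "\<dots> = f (Suc (card Q)) + (\<Sum>b\<in>Q. f (if b = {} then Suc (card Q) else card Q))"
      using fin \<open>{} \<notin> Q\<close> by simp
    also have "(\<Sum>b\<in>Q. f (if b = {} then Suc (card Q) else card Q)) = (\<Sum>b\<in>Q. f (card Q))"
      by (rule sum.cong[OF refl]) (use \<open>{} \<notin> Q\<close> in auto)
    finally show "(\<Sum>b\<in>insert {} Q. f (card (insert (insert x b) (Q - {b})))) =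
        f (Suc (card Q)) + card Q * f (card Q)" by simp
  qed
  finally show ?thesis .
qed

lemma sum_insert_elem:
  fixes f :: "nat \<Rightarrow> nat"
  shows "(\<Sum>P\<leftarrow>insert_elem x Q. f (length P)) = f (Suc (length Q)) + length Q * f (length Q)"
proof (induction Q arbitrary: f)
  case (Cons b Q)
  have "(\<Sum>P\<leftarrow>insert_elem x Q. f (Suc (length P))) =
      f (Suc (Suc (length Q))) + length Q * f (Suc (length Q))"
    by (rule Cons.IH)
  then show ?case by (simp add: comp_def)
qed simp

lemma sum_insert_all:
  fixes f :: "nat \<Rightarrow> nat"
  shows "(\<Sum>P\<leftarrow>insert_all x Qs. f (length P)) =
    (\<Sum>Q\<leftarrow>Qs. f (Suc (length Q)) + length Q * f (length Q))"
  by (induction Qs) (simp_all add: sum_insert_elem)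

text \<open>
  The statement is about arbitrary weights depending on the number of blocks, since the number of
  successors of a partition does: the induction step for the weight \<open>f\<close> uses the weight
  \<open>f (k + 1) + k f(k)\<close> one level below.
\<close>

lemma sum_partitions_eq_sum_set_partitions:
  fixes f :: "nat \<Rightarrow> nat"
  shows "(\<Sum>P | partition_on {1..n} P. f (card P)) = (\<Sum>P\<leftarrow>set_partitions n. f (length P))"
proof (induction n arbitrary: f)
  case 0
  then show ?case by (simp add: partition_on_empty)
next
  case (Suc n)
  have "{1..Suc n} = insert (Suc n) {1..n}" by auto
  then show ?case
    using sum_partitions_insert[of "{1..n}" "Suc n" f]
      Suc.IH[of "\<lambda>k. f (Suc k) + k * f k"]
    by (simp add: sum_insert_all)
qed

lemma length_set_partitions: "length (set_partitions n) = bell n"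
  using sum_partitions_eq_sum_set_partitions[where n = n and f = "\<lambda>_. 1"]
  by (simp add: bell_def sum_list_triv)

lemma bell_Suc: "bell (Suc n) = (\<Sum>P\<leftarrow>set_partitions n. Suc (length P))"
  using sum_insert_all[where f = "\<lambda>_. 1" and x = "Suc n" and Qs = "set_partitions n"]
  by (simp flip: length_set_partitions add: sum_list_triv)

lemma set_insert_elem:
  "P \<in> set (insert_elem x Q) \<Longrightarrow>
    length P \<le> Suc (length Q) \<and> P \<noteq> [] \<and> (\<Sum>b\<leftarrow>P. length b) = Suc (\<Sum>b\<leftarrow>Q. length b)"
  by (induction Q arbitrary: P) fastforce+

lemma set_insert_all: "set (insert_all x Qs) = (\<Union>Q\<in>set Qs. set (insert_elem x Q))"
  by (induction Qs) auto

lemma set_set_partitions: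
  "P \<in> set (set_partitions n) \<Longrightarrow> length P \<le> n \<and> (n > 0 \<longrightarrow> P \<noteq> []) \<and> (\<Sum>b\<leftarrow>P. length b) = n"
proof (induction n arbitrary: P)
  case (Suc n)
  then obtain Q where "Q \<in> set (set_partitions n)" "P \<in> set (insert_elem (Suc n) Q)"
    by (auto simp: set_insert_all)
  with Suc.IH[of Q] set_insert_elem[of P "Suc n" Q] show ?case by auto
qed simp

text \<open>
  A partition of a nonempty set has a block, and hence at least two successors.
\<close>

lemma bell_double:
  assumes "n \<ge> 1"
  shows "2 * bell n \<le> bell (Suc n)"
proof -
  have "(\<Sum>P\<leftarrow>set_partitions n. 2) \<le> (\<Sum>P\<leftarrow>set_partitions n. Suc (length P))"
  proof (rule sum_list_mono)
    fix P assume "P \<in> set (set_partitions n)"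
    then have "P \<noteq> []" using set_set_partitions assms by force
    then show "2 \<le> Suc (length P)" by (cases P) auto
  qed
  then show ?thesis unfolding bell_Suc by (simp add: sum_list_triv length_set_partitions mult.commute)
qed

lemma bell_ge: "2 ^ n \<le> bell (Suc n)"
proof (induction n)
  case 0
  show ?case by (simp add: bell_Suc)
next
  case (Suc n)
  then show ?case using bell_double[of "Suc n"] by simp
qed

lemma bell_pos:
  assumes "n \<ge> 1"
  shows "1 \<le> bell n"
proof -
  obtain m where "n = Suc m" using assms by (cases n) auto
  then show ?thesis by (simp only:) (rule order_trans[OF _ bell_ge], simp)
qed

text \<open>
  The Bell numbers at least double in each step, so their sum is dominated by the last one.
\<close>

lemma sum_bell_le: "(\<Sum>k=1..n. bell k) \<le> 2 * bell n"
proof (induction n)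
  case (Suc n)
  show ?case
  proof (cases "n = 0")
    case False
    then show ?thesis using Suc bell_double[of n] by simp
  qed simp
qed simp

section \<open>Running time of the enumeration\<close>

lemma length_insert_elem [simp]: "length (insert_elem x P) = Suc (length P)"
  by (induction P) auto

text \<open>
  The growth is quadratic because each recursive call traverses the list returned by the next one.
\<close>

lemma T_insert_elem_le: "T_insert_elem x P \<le> 6 * (Suc (length P))\<^sup>2"
  by (induction P) (auto simp: T_map sum_list_triv power2_eq_square)

lemma T_insert_all_eq:
  "T_insert_all x Ps = (\<Sum>P\<leftarrow>Ps. T_insert_elem x P + (length P + 3)) + 1"
  by (induction Ps) (auto simp: T_append)

text \<open>
  The quadratic cost \<open>(p + 1)\<^sup>2\<close> for a partition with \<open>p\<close> blocks is at most \<open>(n + 1) (p + 1)\<close>, and the sum of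
  \<open>p + 1\<close> over all partitions is the next Bell number.
\<close>

lemma T_insert_all_set_partitions_le:
  "T_insert_all (Suc n) (set_partitions n) \<le> 9 * (Suc n * bell (Suc n)) + 1"
proof -
  have "(\<Sum>P\<leftarrow>set_partitions n. T_insert_elem (Suc n) P + (length P + 3))
      \<le> (\<Sum>P\<leftarrow>set_partitions n. 9 * (Suc n * Suc (length P)))"
  proof (rule sum_list_mono)
    fix P assume "P \<in> set (set_partitions n)"
    then have P: "length P \<le> n" using set_set_partitions by blast
    let ?p = "Suc (length P)"
    have "?p * ?p \<le> Suc n * ?p" using P by (intro mult_right_mono) auto
    moreover have "length P + 3 \<le> 3 * (Suc n * ?p)" by simp
    ultimately show "T_insert_elem (Suc n) P + (length P + 3) \<le> 9 * (Suc n * ?p)"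
      using T_insert_elem_le[of "Suc n" P] unfolding power2_eq_square by linarith
  qed
  also have "\<dots> = 9 * (Suc n * bell (Suc n))"
    unfolding bell_Suc sum_list_const_mult by simp
  finally show ?thesis unfolding T_insert_all_eq by simp
qed

lemma T_set_partitions_le: "T_set_partitions n \<le> 9 * (n * (\<Sum>k=1..n. bell k)) + 2 * n + 1"
proof (induction n)
  case (Suc n)
  have "9 * (n * (\<Sum>k=1..n. bell k)) \<le> 9 * (Suc n * (\<Sum>k=1..n. bell k))" by simp
  then show ?case using Suc T_insert_all_set_partitions_le[of n] by (simp add: algebra_simps)
qed simp

lemma T_signed_fact_eq: "T_signed_fact m = Suc m"
  by (induction m) auto

lemma T_block_product_eq: "T_block_product P = (\<Sum>b\<leftarrow>P. length b) + 2 * length P + 1"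
  by (induction P) (auto simp: T_length)

lemma T_sum_contributions_eq:
  "T_sum_contributions Ps = (\<Sum>P\<leftarrow>Ps. T_contribution P + 1) + 1"
  by (induction Ps) auto

text \<open>
  Measuring the blocks takes at least one step for each of the \<open>n\<close> elements; everything else is linear in
  the number of blocks.
\<close>

lemma T_contribution_bounds:
  assumes "P \<in> set (set_partitions n)"
  shows "n \<le> T_contribution P" "T_contribution P \<le> 5 * n + 4"
  using set_set_partitions[OF assms]
  by (auto simp: T_contribution_def T_length T_signed_fact_eq T_block_product_eq)

lemma T_classical_cumulant_ge: "n * bell n \<le> T_classical_cumulant n"
proof -
  have "(\<Sum>P\<leftarrow>set_partitions n. n) \<le> (\<Sum>P\<leftarrow>set_partitions n. T_contribution P + 1)"
    by (rule sum_list_mono) (use T_contribution_bounds(1) in force)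
  then show ?thesis
    by (simp add: T_classical_cumulant_def T_sum_contributions_eq sum_list_triv
        length_set_partitions mult.commute)
qed

lemma T_classical_cumulant_le:
  assumes "n \<ge> 1"
  shows "T_classical_cumulant n \<le> 33 * (n * bell n)"
proof -
  have "(\<Sum>P\<leftarrow>set_partitions n. T_contribution P + 1) \<le> (\<Sum>P\<leftarrow>set_partitions n. 10 * n)"
  proof (rule sum_list_mono)
    fix P assume "P \<in> set (set_partitions n)"
    then show "T_contribution P + 1 \<le> 10 * n"
      using T_contribution_bounds(2)[of P n] assms by simp
  qed
  then have 1: "T_sum_contributions (set_partitions n) \<le> 10 * (n * bell n) + 1"
    by (simp add: T_sum_contributions_eq sum_list_triv length_set_partitions mult_ac)
  have "n * (\<Sum>k=1..n. bell k) \<le> n * (2 * bell n)" by (rule mult_le_mono2[OF sum_bell_le])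
  then have 2: "T_set_partitions n \<le> 18 * (n * bell n) + 2 * n + 1"
    using T_set_partitions_le[of n] by linarith
  have "n \<le> n * bell n" using bell_pos[OF assms] by simp
  then show ?thesis using 1 2 assms unfolding T_classical_cumulant_def by linarith
qed

lemma T_classical_cumulants_eq:
  "T_classical_cumulants n = (\<Sum>k=1..n. T_classical_cumulant k) + n + 1"
  by (simp add: T_classical_cumulants_def T_map interv_sum_list_conv_sum_set_nat
      atLeastLessThanSuc_atLeastAtMost del: upt_Suc)

lemma T_classical_cumulants_ge: "n \<ge> 1 \<Longrightarrow> n * bell n \<le> T_classical_cumulants n"
  unfolding T_classical_cumulants_eq using T_classical_cumulant_ge[of n]
    member_le_sum[of n "{1..n}" T_classical_cumulant] by simp

lemma T_classical_cumulants_le: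
  assumes "n \<ge> 1"
  shows "T_classical_cumulants n \<le> 68 * (n * bell n)"
proof -
  have "(\<Sum>k=1..n. T_classical_cumulant k) \<le> (\<Sum>k=1..n. 33 * n * bell k)"
  proof (rule sum_mono)
    fix k assume k: "k \<in> {1..n}"
    then have "T_classical_cumulant k \<le> 33 * (k * bell k)" by (intro T_classical_cumulant_le) auto
    also have "\<dots> \<le> 33 * n * bell k" using k by simp
    finally show "T_classical_cumulant k \<le> 33 * n * bell k" .
  qed
  also have "\<dots> = 33 * n * (\<Sum>k=1..n. bell k)" by (simp only: sum_distrib_left)
  also have "\<dots> \<le> 33 * n * (2 * bell n)" by (rule mult_le_mono2[OF sum_bell_le])
  also have "\<dots> = 66 * (n * bell n)" by simp
  finally have "(\<Sum>k=1..n. T_classical_cumulant k) \<le> 66 * (n * bell n)" .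
  moreover have "n \<le> n * bell n" using bell_pos[OF assms] by simp
  ultimately show ?thesis using assms unfolding T_classical_cumulants_eq by linarith
qed

section \<open>The comparison\<close>

lemma bigtheta_real_natI:
  fixes f g :: "nat \<Rightarrow> nat"
  assumes "a > 0" "b > 0" "\<And>n. n \<ge> N \<Longrightarrow> g n \<le> a * f n" "\<And>n. n \<ge> N \<Longrightarrow> f n \<le> b * g n"
  shows "(\<lambda>n. real (f n)) \<in> \<Theta>(\<lambda>n. real (g n))"
proof (rule bigthetaI)
  have "real (f n) \<le> real b * real (g n)" if "n \<ge> N" for n
    using assms(4)[OF that] by (simp flip: of_nat_mult)
  then show "(\<lambda>n. real (f n)) \<in> O(\<lambda>n. real (g n))"
    by (intro bigoI[where c = "real b"] eventually_at_top_linorderI[of N]) auto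
  have "real (g n) \<le> real a * real (f n)" if "n \<ge> N" for n
    using assms(3)[OF that] by (simp flip: of_nat_mult)
  then have "(\<lambda>n. real (g n)) \<in> O(\<lambda>n. real (f n))"
    by (intro bigoI[where c = "real a"] eventually_at_top_linorderI[of N]) auto
  then show "(\<lambda>n. real (f n)) \<in> \<Omega>(\<lambda>n. real (g n))"
    by (simp add: bigomega_iff_bigo)
qed

lemma bell_superpolynomial_over_mult_cost:
  fixes d :: real
  shows "filterlim (\<lambda>n. (real n * real (bell n) / real (mult_cost n)) / real n powr d) at_top at_top"
proof (rule filterlim_at_top_mono)
  \<comment> \<open>for \<open>n \<ge> 1\<close>, \<open>bell n \<ge> 2 ^ n / 2\<close> and \<open>M(n) \<le> 2 (n + 1)\<^sup>2 \<le> 8 n\<^sup>2\<close>\<close>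
  show "filterlim (\<lambda>n::nat. 2 ^ n / (16 * (real n * real n powr d))) at_top at_top"
    by real_asymp
  show "\<forall>\<^sub>F n in at_top. 2 ^ n / (16 * (real n * real n powr d))
      \<le> (real n * real (bell n) / real (mult_cost n)) / real n powr d"
  proof (rule eventually_at_top_linorderI[of 1])
    fix n :: nat assume n: "n \<ge> 1"
    obtain m where m: "n = Suc m" using n by (cases n) auto
    have "real (2 ^ m) \<le> real (bell n)" unfolding m of_nat_le_iff by (rule bell_ge)
    then have B: "2 ^ n \<le> 2 * real (bell n)" by (simp add: m)
    have "(Suc n)\<^sup>2 \<le> (2 * n)\<^sup>2" using n by (intro power_mono) auto
    then have "mult_cost n \<le> 8 * n * n"
      using mult_cost_le[of n] by (simp add: power2_eq_square)
    then have M: "real (mult_cost n) \<le> 8 * real n * real n"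
      by (metis of_nat_le_iff of_nat_mult of_nat_numeral)
    have pos: "real (mult_cost n) > 0" using mult_cost_ge[of n] by simp
    have "2 ^ n / (16 * real n) * real (mult_cost n) \<le> 2 * real (bell n) / (16 * real n) * (8 * real n * real n)"
      using B M by (intro mult_mono divide_right_mono) auto
    also have "\<dots> = real n * real (bell n)" using n by simp
    finally have "2 ^ n / (16 * real n) \<le> real n * real (bell n) / real (mult_cost n)"
      using pos by (simp only: pos_le_divide_eq)
    then have "2 ^ n / (16 * real n) / real n powr d
        \<le> real n * real (bell n) / real (mult_cost n) / real n powr d"
      by (rule divide_right_mono) simp
    then show "2 ^ n / (16 * (real n * real n powr d))
        \<le> real n * real (bell n) / real (mult_cost n) / real n powr d"
      by (simp add: mult.assoc)
  qed
qed

theorem corollary1: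
  assumes "\<And>n. n \<ge> 1 \<Longrightarrow> mult_cost (2 * n) \<ge> 2 * mult_cost n"
  shows "(\<lambda>n. real (arith_complexity n (cumulant_problem n))) \<in> \<Theta>(\<lambda>n. real (mult_cost n)) \<and>
    (\<lambda>n. real (T_classical_cumulant n)) \<in> \<Theta>(\<lambda>n. real n * real (bell n)) \<and>
    (\<lambda>n. real (T_classical_cumulants n)) \<in> \<Theta>(\<lambda>n. real n * real (bell n)) \<and>
    (\<forall>d::real. filterlim
       (\<lambda>n. (real n * real (bell n) / real (mult_cost n)) / real n powr d) at_top at_top)"
proof (intro conjI allI)
  show "(\<lambda>n. real (arith_complexity n (cumulant_problem n))) \<in> \<Theta>(\<lambda>n. real (mult_cost n))"
  \<comment> \<open>\<open>M \<le> 16 L + 12 (n + 1) \<le> 28 L + 24\<close> by \<open>n \<le> L + 1\<close>, and \<open>L \<ge> 1\<close> once \<open>n \<ge> 2\<close>\<close>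
  proof (rule bigtheta_real_natI[of 52 10 2])
    fix n :: nat assume "n \<ge> 2"
    then show "mult_cost n \<le> 52 * arith_complexity n (cumulant_problem n)"
      using mult_cost_le_cumulant_cost[OF assms, of n] cumulant_cost_ge[OF assms, of n] by simp
  qed (use cumulant_cost_le[OF assms] in auto)
  show "(\<lambda>n. real (T_classical_cumulant n)) \<in> \<Theta>(\<lambda>n. real n * real (bell n))"
    unfolding of_nat_mult[symmetric]
    by (rule bigtheta_real_natI[of 1 33 1]) (use T_classical_cumulant_ge T_classical_cumulant_le in auto)
  show "(\<lambda>n. real (T_classical_cumulants n)) \<in> \<Theta>(\<lambda>n. real n * real (bell n))"
    unfolding of_nat_mult[symmetric]
    by (rule bigtheta_real_natI[of 1 68 1]) (use T_classical_cumulants_ge T_classical_cumulants_le in auto)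
qed (rule bell_superpolynomial_over_mult_cost)

end
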